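(* For an arbitrary snark $G$, the following statements are equivalent: (i) $G$ is critical; (ii) $G$ is $4$-edge-critical; (iii) $G$ is $5$-irreducible; (iv) $G$ is $6$-irreducible; (v) $G\sim e$ is $3$-edge-colourable for each edge $e$ of $G$.
   Context: Graphs may have parallel edges and loops. A snark is a connected cubic graph that admits no proper edge-colouring with three colours (equivalently, no nowhere-zero $4$-flow). For distinct vertices $u,v$ of $G$, $G-\{u,v\}$ denotes the graph obtained by removing $u$ and $v$ but retaining the edges formerly incident with them as dangling edges, and $G/\{u,v\}$ denotes the graph obtained by identifying $u$ and $v$. For an edge $e$, $G\sim e$ denotes the cubic graph obtained from $G-e$ (deletion of $e$) by suppressing the two resulting vertices of degree two. A snark $G$ is critical if $G-\{u,v\}$ is $3$-edge-colourable for every pair of adjacent vertices $u,v$. A snark $G$ is $4$-edge-critical if $G/\{u,v\}$ admits a nowhere-zero $4$-flow for every pair of adjacent vertices $u,v$ (equivalently, $G/e$ has a nowhere-zero $4$-flow for every edge $e$, since loops do not affect existence of nowhere-zero flows). For an integer $k\ge1$, a snark $G$ is $k$-irreducible if removing fewer than $k$ edges from $G$ never produces a component of chromatic index $4$ that can be completed (by adding vertices and edges) to a cubic graph $H$ with fewer vertices than $G$.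
   Formalization: In (v) the edge e ranges over non-loop edges only, since G∼e is undefined for a loop; in k-irreducibility "chromatic index 4" is read as "not 3-edge-colourable", so components with loops count (otherwise K_{1,3} with a loop at each leaf is a counterexample). *)

theory Defs
  imports Main "HOL-Library.Multiset" "HOL-Library.Extended_Nat"
begin

text \<open>
  The end-vertices of an edge form a multiset: two distinct elements for an ordinary edge, a doubled
  element for a loop, a singleton for a dangling edge, and the empty multiset for an edge without
  end-vertices (an isolated edge both of whose ends dangle, or a vertexless circle).
\<close>

record ('v, 'e) multigraph =
  verts :: "'v set"
  edges :: "'e set"
  ends :: "'e \<Rightarrow> 'v multiset"

text \<open>A finite graph in the usual sense: parallel edges and loops, but no dangling edges.\<close>

definition fin_graph :: "('v, 'e) multigraph \<Rightarrow> bool" where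
  "fin_graph G \<longleftrightarrow> finite (verts G) \<and> finite (edges G) \<and>
     (\<forall>e\<in>edges G. size (ends G e) = 2 \<and> set_mset (ends G e) \<subseteq> verts G)"

definition is_loop :: "('v, 'e) multigraph \<Rightarrow> 'e \<Rightarrow> bool" where
  "is_loop G e \<longleftrightarrow> (\<exists>v. ends G e = {#v, v#})"

definition degree :: "('v, 'e) multigraph \<Rightarrow> 'v \<Rightarrow> nat" where
  "degree G v = (\<Sum>e\<in>edges G. count (ends G e) v)"

definition cubic_graph :: "('v, 'e) multigraph \<Rightarrow> bool" where
  "cubic_graph G \<longleftrightarrow> fin_graph G \<and> (\<forall>v\<in>verts G. degree G v = 3)"

definition adjacent :: "('v, 'e) multigraph \<Rightarrow> 'v \<Rightarrow> 'v \<Rightarrow> bool" where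
  "adjacent G u v \<longleftrightarrow> u \<noteq> v \<and> (\<exists>e\<in>edges G. ends G e = {#u, v#})"

definition reachable :: "('v, 'e) multigraph \<Rightarrow> 'v \<Rightarrow> 'v \<Rightarrow> bool" where
  "reachable G = (adjacent G)\<^sup>*\<^sup>*"

definition connected_graph :: "('v, 'e) multigraph \<Rightarrow> bool" where
  "connected_graph G \<longleftrightarrow> (\<forall>u\<in>verts G. \<forall>v\<in>verts G. reachable G u v)"

definition component_of :: "('v, 'e) multigraph \<Rightarrow> 'v \<Rightarrow> ('v, 'e) multigraph" where
  "component_of G v =
     (let W = {w \<in> verts G. reachable G v w}
      in \<lparr>verts = W, edges = {e \<in> edges G. set_mset (ends G e) \<inter> W \<noteq> {}}, ends = ends G\<rparr>)"

definition components :: "('v, 'e) multigraph \<Rightarrow> ('v, 'e) multigraph set" where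
  "components G = component_of G ` verts G"

definition subgraph :: "('v, 'e) multigraph \<Rightarrow> ('v, 'e) multigraph \<Rightarrow> bool" where
  "subgraph C H \<longleftrightarrow> verts C \<subseteq> verts H \<and> edges C \<subseteq> edges H \<and> (\<forall>e\<in>edges C. ends C e = ends H e)"

text \<open>A loop is adjacent to itself, so a graph with a loop has no proper edge-colouring.\<close>

definition proper_edge_colouring :: "('v, 'e) multigraph \<Rightarrow> nat \<Rightarrow> ('e \<Rightarrow> nat) \<Rightarrow> bool" where
  "proper_edge_colouring G k c \<longleftrightarrow>
     (\<forall>e\<in>edges G. c e < k \<and> \<not> is_loop G e) \<and>
     (\<forall>e\<in>edges G. \<forall>f\<in>edges G. e \<noteq> f \<and> set_mset (ends G e) \<inter> set_mset (ends G f) \<noteq> {} \<longrightarrow> c e \<noteq> c f)"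

definition edge_colourable :: "('v, 'e) multigraph \<Rightarrow> nat \<Rightarrow> bool" where
  "edge_colourable G k \<longleftrightarrow> (\<exists>c. proper_edge_colouring G k c)"

text \<open>The value is infinite exactly when no proper colouring exists, as for graphs with loops.\<close>

definition chromatic_index :: "('v, 'e) multigraph \<Rightarrow> enat" where
  "chromatic_index G = (INF k \<in> {k. edge_colourable G k}. enat k)"

definition snark :: "('v, 'e) multigraph \<Rightarrow> bool" where
  "snark G \<longleftrightarrow> cubic_graph G \<and> connected_graph G \<and> \<not> edge_colourable G 3"

definition nowhere_zero_flow :: "('v, 'e) multigraph \<Rightarrow> nat \<Rightarrow> bool" where
  "nowhere_zero_flow G k \<longleftrightarrow>
     (\<exists>(tail :: 'e \<Rightarrow> 'v) (head :: 'e \<Rightarrow> 'v) (f :: 'e \<Rightarrow> int).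
        (\<forall>e\<in>edges G. ends G e = {#tail e, head e#} \<and> f e \<noteq> 0 \<and> \<bar>f e\<bar> < int k) \<and>
        (\<forall>v\<in>verts G. (\<Sum>e | e \<in> edges G \<and> head e = v. f e) = (\<Sum>e | e \<in> edges G \<and> tail e = v. f e)))"

text \<open>Removal of vertices keeps every edge; it only loses its ends in the removed set.\<close>

definition remove_verts :: "('v, 'e) multigraph \<Rightarrow> 'v set \<Rightarrow> ('v, 'e) multigraph" where
  "remove_verts G S =
     \<lparr>verts = verts G - S, edges = edges G, ends = (\<lambda>e. filter_mset (\<lambda>x. x \<notin> S) (ends G e))\<rparr>"

text \<open>The vertex resulting from the identification is called \<open>u\<close>; edges joining \<open>u\<close> and \<open>v\<close> become loops.\<close>

definition identify :: "('v, 'e) multigraph \<Rightarrow> 'v \<Rightarrow> 'v \<Rightarrow> ('v, 'e) multigraph" where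
  "identify G u v =
     \<lparr>verts = verts G - {v}, edges = edges G,
      ends = (\<lambda>e. image_mset (\<lambda>x. if x = v then u else x) (ends G e))\<rparr>"

definition delete_edges :: "('v, 'e) multigraph \<Rightarrow> 'e set \<Rightarrow> ('v, 'e) multigraph" where
  "delete_edges G F = \<lparr>verts = verts G, edges = edges G - F, ends = ends G\<rparr>"

text \<open>
  Suppression of a set \<open>S\<close> of vertices of degree two. Edges meeting in a vertex of \<open>S\<close> are merged, so
  the new edges are the classes of the equivalence relation generated by sharing an end in \<open>S\<close>.
  The edges of a class form a path, whose ends outside \<open>S\<close> are the ends of the new edge, or a
  circuit with all its vertices in \<open>S\<close>, which becomes a vertexless circle.
\<close>

definition suppress :: "('v, 'e) multigraph \<Rightarrow> 'v set \<Rightarrow> ('v, 'e set) multigraph" where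
  "suppress G S =
     \<lparr>verts = verts G - S,
      edges = edges G // {(a, b). a \<in> edges G \<and> b \<in> edges G \<and>
                                  set_mset (ends G a) \<inter> set_mset (ends G b) \<inter> S \<noteq> {}}\<^sup>*,
      ends = (\<lambda>K. \<Sum>a\<in>K. filter_mset (\<lambda>x. x \<notin> S) (ends G a))\<rparr>"

text \<open>
  In a cubic graph the deletion of \<open>e\<close> leaves two vertices of degree two precisely when \<open>e\<close> is not
  a loop; the operation is meaningful only for such edges.
\<close>

definition delete_suppress :: "('v, 'e) multigraph \<Rightarrow> 'e \<Rightarrow> ('v, 'e set) multigraph" where
  "delete_suppress G e =
     (let D = delete_edges G {e} in suppress D {w \<in> verts D. degree D w = 2})"

definition critical :: "('v, 'e) multigraph \<Rightarrow> bool" where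
  "critical G \<longleftrightarrow>
     (\<forall>u\<in>verts G. \<forall>v\<in>verts G. adjacent G u v \<longrightarrow> edge_colourable (remove_verts G {u, v}) 3)"

definition four_edge_critical :: "('v, 'e) multigraph \<Rightarrow> bool" where
  "four_edge_critical G \<longleftrightarrow>
     (\<forall>u\<in>verts G. \<forall>v\<in>verts G. adjacent G u v \<longrightarrow> nowhere_zero_flow (identify G u v) 4)"

text \<open>
  A loopless graph of maximum degree at most three has chromatic index at most four, so the
  condition \<open>4 \<le> chromatic_index C\<close> says that the index is four, except that it also covers
  components containing loops, which have no proper edge-colouring at all.
  Letting \<open>H\<close> range over graphs on the vertex and edge types of \<open>G\<close> is no restriction: \<open>G\<close>
  is cubic, so \<open>H\<close> has fewer vertices and fewer edges than \<open>G\<close>.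
\<close>

definition irreducible_graph :: "nat \<Rightarrow> ('v, 'e) multigraph \<Rightarrow> bool" where
  "irreducible_graph k G \<longleftrightarrow>
     \<not> (\<exists>F C H. F \<subseteq> edges G \<and> card F < k \<and>
           C \<in> components (delete_edges G F) \<and> 4 \<le> chromatic_index C \<and>
           cubic_graph H \<and> subgraph C H \<and> card (verts H) < card (verts G))"

end

theory Submission imports Defs begin

text \<open>
  In a cubic graph, a 3-edge-colouring is a nowhere-zero flow with values in the Klein four-group,
  encoded by a pair of edge sets that cover all edges and are even at every vertex. By the
  handshake lemma, conservation at all vertices but one implies conservation at the last one.
  Hence colourings of \<open>G - {u, v}\<close> correspond to Klein flows on \<open>G/{u, v}\<close>, and by Tutte's theorem
  (derived from balanced orientations of even graphs) to integer 4-flows. For an edge \<open>e = uv\<close>, a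
  colouring of \<open>G - {u, v}\<close> has the same imbalance at \<open>u\<close> and at \<open>v\<close> when \<open>e\<close> is ignored; a nonzero
  imbalance could be put on \<open>e\<close> to colour \<open>G\<close>, so it vanishes and the colouring descends to \<open>G ~ e\<close>.

  If \<open>G - {u, v}\<close> is not colourable, then cutting the at most four edges leaving \<open>{u, v}\<close> leaves an
  uncolourable component, and joining the cut ends in pairs completes it without \<open>u\<close> and \<open>v\<close>.
  Conversely, if at most five edges cut off an uncolourable component \<open>C\<close> contained in a smaller cubic
  graph, then by parity at least two vertices lie outside \<open>C\<close>. Criticality makes them independent
  and, with connectedness, loopless, so they send at least six edges to \<open>C\<close>.
\<close>

subsection \<open>Colourings and even edge sets\<close>

text \<open>A loop occurs twice in this multiset. A vertex of degree three can thus be handled by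
  naming its three incidences as \<open>{#x, y, z#}\<close>, with distinctness still to be
  proved.\<close>

definition incidences :: "('v, 'e) multigraph \<Rightarrow> 'v \<Rightarrow> 'e multiset" where
  "incidences G v = (\<Sum>e\<in>edges G. replicate_mset (count (ends G e) v) e)"

text \<open>This is conservation at \<open>v\<close> for a flow with values modulo two and support
  \<open>A\<close>; a loop contributes two and so never matters.\<close>

definition even_at :: "('v, 'e) multigraph \<Rightarrow> 'e set \<Rightarrow> 'v \<Rightarrow> bool" where
  "even_at G A v \<longleftrightarrow> even (\<Sum>e\<in>A. count (ends G e) v)"

lemma count_incidences:
  assumes "finite (edges G)"
  shows "count (incidences G v) e = (if e \<in> edges G then count (ends G e) v else 0)"
  using assms by (simp add: incidences_def count_sum if_distrib sum.delta' cong: if_cong)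

lemma size_incidences: "size (incidences G v) = degree G v"
proof -
  have "size (\<Sum>e\<in>E. replicate_mset (f e) e) = (\<Sum>e\<in>E. f e)" for E :: "'b set" and f
    by (induction E rule: infinite_finite_induct) auto
  then show ?thesis by (simp add: incidences_def degree_def)
qed

lemma size_filter_incidences:
  fixes G :: "('v, 'e) multigraph"
  assumes "finite (edges G)" "A \<subseteq> edges G"
  shows "size (filter_mset (\<lambda>e. e \<in> A) (incidences G v)) = (\<Sum>e\<in>A. count (ends G e) v)"
proof -
  have "size (filter_mset (\<lambda>e. e \<in> A) (\<Sum>e\<in>E. replicate_mset (f e) e)) = (\<Sum>e\<in>A \<inter> E. f e)"
    if "finite E" for E :: "'e set" and f
    using that
  proof (induction E)
    case (insert x E)
    have "filter_mset (\<lambda>e. e \<in> A) (replicate_mset (f x) x) =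
        (if x \<in> A then replicate_mset (f x) x else {#})"
      by (auto intro!: multiset_eqI)
    then show ?case using insert by (auto simp: Int_insert_right)
  qed simp
  from this[OF assms(1), of "\<lambda>e. count (ends G e) v"] show ?thesis
    using assms(2) by (simp add: incidences_def Int_absorb2)
qed

lemma size_three_multiset:
  assumes "size M = 3" obtains x y z where "M = {#x, y, z#}"
proof -
  obtain x N where N: "M = add_mset x N" "size N = 2"
    using assms size_eq_Suc_imp_eq_union[of M 2] by auto
  obtain y N' where N': "N = add_mset y N'" "size N' = 1"
    using N(2) size_eq_Suc_imp_eq_union[of N 1] by auto
  obtain z where "N' = {#z#}" using N'(2) size_1_singleton_mset by blast
  with N N' that show thesis by simp
qed

lemma even_at_incidences:
  assumes "finite (edges G)" "A \<subseteq> edges G"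
  shows "even_at G A v \<longleftrightarrow> even (size (filter_mset (\<lambda>e. e \<in> A) (incidences G v)))"
  by (simp add: even_at_def size_filter_incidences[OF assms])

lemma in_incidences:
  assumes "finite (edges G)"
  shows "e \<in># incidences G v \<longleftrightarrow> e \<in> edges G \<and> v \<in># ends G e"
  using count_incidences[OF assms, of v e]
  by (auto simp flip: count_greater_zero_iff split: if_splits)

lemma size_le_two_loop:
  assumes "size M \<le> 2" "2 \<le> count M v"
  shows "M = {#v, v#}"
proof -
  have "{#v, v#} \<subseteq># M"
    using assms(2) count_le_replicate_mset_subset_eq[of 2 M v] by (simp add: numeral_2_eq_2)
  then obtain N where N: "M = {#v, v#} + N" by (metis mset_subset_eq_exists_conv)
  then have "N = {#}" using assms(1) by simp
  then show ?thesis using N by simp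
qed

lemma proper_imp_even_at:
  assumes fin: "finite (edges G)" and sz: "\<And>e. e \<in> edges G \<Longrightarrow> size (ends G e) \<le> 2"
    and deg: "degree G v = 3" and c: "proper_edge_colouring G 3 c" and i: "i < 3"
  shows "even_at G {e \<in> edges G. c e \<noteq> i} v"
proof -
  obtain x y z where xyz: "incidences G v = {#x, y, z#}"
    using size_three_multiset deg by (metis size_incidences)
  \<comment> \<open>With at most two ends in total, an edge ending twice at \<open>v\<close> would
    be a loop, which a proper colouring forbids.\<close>
  have "count (ends G e) v < 2" if "e \<in> edges G" for e
    using size_le_two_loop[OF sz[OF that]] c that
    unfolding proper_edge_colouring_def is_loop_def by (meson not_le_imp_less)
  then have "count {#x, y, z#} e < 2" for e
    using count_incidences[OF fin, of v e] xyz by (cases "e \<in> edges G") auto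
  from this[of x] this[of y] have ne: "x \<noteq> y" "x \<noteq> z" "y \<noteq> z" by (auto split: if_splits)
  have inc: "e \<in> edges G \<and> v \<in># ends G e" if "e \<in> {x, y, z}" for e
    using in_incidences[OF fin, of e v] xyz that by auto
  have cc: "c e \<noteq> c f" if "e \<in> {x, y, z}" "f \<in> {x, y, z}" "e \<noteq> f" for e f
    using c inc[OF that(1)] inc[OF that(2)] that(3) unfolding proper_edge_colouring_def by blast
  have c3: "c e < 3" if "e \<in> {x, y, z}" for e
    using c inc[OF that] unfolding proper_edge_colouring_def by blast
  have ccc: "c x \<noteq> c y" "c x \<noteq> c z" "c y \<noteq> c z" using cc ne by auto
  then have "card {c x, c y, c z} = 3" by simp
  moreover have "{c x, c y, c z} \<subseteq> {..<3}" using c3 by auto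
  ultimately have "{c x, c y, c z} = {..<3}" by (intro card_subset_eq) auto
  then have "i \<in> {c x, c y, c z}" using i by auto
  with ccc have "(c x = i \<and> c y \<noteq> i \<and> c z \<noteq> i) \<or> (c x \<noteq> i \<and> c y = i \<and> c z \<noteq> i) \<or>
      (c x \<noteq> i \<and> c y \<noteq> i \<and> c z = i)"
    by (elim insertE emptyE) simp_all
  moreover have "x \<in> edges G" "y \<in> edges G" "z \<in> edges G" using inc by auto
  ultimately have "even (size (filter_mset (\<lambda>e. e \<in> {e \<in> edges G. c e \<noteq> i}) {#x, y, z#}))"
    by (elim disjE conjE) simp_all
  then show ?thesis by (subst even_at_incidences[OF fin]) (simp_all add: xyz)
qed

text \<open>The colours stand for the three nonzero elements of the Klein group. On a cover this
  inverts the passage from a colouring \<open>c\<close> to the sets \<open>c e \<noteq> 0\<close>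
  and \<open>c e \<noteq> 1\<close>.\<close>

definition cover_colouring :: "'e set \<Rightarrow> 'e set \<Rightarrow> 'e \<Rightarrow> nat" where
  "cover_colouring A B e = (if e \<notin> A then 0 else if e \<notin> B then 1 else 2)"

text \<open>Three nonzero elements of the Klein group sum to zero only if they are pairwise
  distinct: two equal ones would cancel and leave the third. Distinct colours force distinct edges,
  which also excludes a loop at \<open>v\<close>.\<close>

lemma even_imp_proper_at:
  assumes fin: "finite (edges G)" and AB: "A \<union> B = edges G" and deg: "degree G v = 3"
    and ev: "even_at G A v" "even_at G B v"
  shows "count (ends G e) v < 2 \<or> e \<notin> edges G"
    and "e \<in> edges G \<Longrightarrow> f \<in> edges G \<Longrightarrow> e \<noteq> f \<Longrightarrow> v \<in># ends G e \<Longrightarrow> v \<in># ends G f \<Longrightarrow>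
      cover_colouring A B e \<noteq> cover_colouring A B f"
proof -
  obtain x y z where xyz: "incidences G v = {#x, y, z#}"
    using size_three_multiset deg by (metis size_incidences)
  have inE: "x \<in> A \<or> x \<in> B" "y \<in> A \<or> y \<in> B" "z \<in> A \<or> z \<in> B"
    using in_incidences[OF fin, of _ v] xyz AB by auto
  have "even (size (filter_mset (\<lambda>e. e \<in> A) {#x, y, z#}))" "even (size (filter_mset (\<lambda>e. e \<in> B) {#x, y, z#}))"
    using ev even_at_incidences[OF fin, of A v] even_at_incidences[OF fin, of B v] AB
    unfolding xyz[symmetric] by blast+
  then have cc: "cover_colouring A B x \<noteq> cover_colouring A B y" "cover_colouring A B x \<noteq> cover_colouring A B z"
    "cover_colouring A B y \<noteq> cover_colouring A B z"
    using inE by (auto simp: cover_colouring_def split: if_splits)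
  then have "x \<noteq> y" "x \<noteq> z" "y \<noteq> z" by auto
  then have "count {#x, y, z#} e < 2" by auto
  then show "count (ends G e) v < 2 \<or> e \<notin> edges G"
    using count_incidences[OF fin, of v e] xyz by (auto split: if_splits)
  assume "e \<in> edges G" "f \<in> edges G" "e \<noteq> f" "v \<in># ends G e" "v \<in># ends G f"
  then have "e \<in> {x,y,z}" "f \<in> {x,y,z}"
    using in_incidences[OF fin, of _ v] xyz by auto
  with cc \<open>e \<noteq> f\<close> show "cover_colouring A B e \<noteq> cover_colouring A B f" by auto
qed

text \<open>
  A pair \<open>A\<close>, \<open>B\<close> of edge sets covering all edges is a nowhere-zero map from the edges to the group
  of order four and exponent two; it is conserved at \<open>v\<close> iff both sets are even at \<open>v\<close>.
\<close>

definition double_cover :: "('v, 'e) multigraph \<Rightarrow> 'v set \<Rightarrow> 'e set \<Rightarrow> 'e set \<Rightarrow> bool" where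
  "double_cover G W A B \<longleftrightarrow> A \<union> B = edges G \<and> (\<forall>v\<in>W. even_at G A v \<and> even_at G B v)"

section \<open>Colourings after removal of vertices\<close>

lemma count_remove_verts: "w \<notin> S \<Longrightarrow> count (ends (remove_verts G S) e) w = count (ends G e) w"
  by (simp add: remove_verts_def)

lemma degree_remove_verts: "w \<notin> S \<Longrightarrow> degree (remove_verts G S) w = degree G w"
  by (simp add: degree_def count_remove_verts) (simp add: remove_verts_def)

lemma even_at_remove_verts: "w \<notin> S \<Longrightarrow> even_at (remove_verts G S) A w = even_at G A w"
  by (simp add: even_at_def count_remove_verts)

lemma edges_remove_verts [simp]: "edges (remove_verts G S) = edges G"
  by (simp add: remove_verts_def)

lemma cubic_graphD:
  assumes "cubic_graph G"
  shows "finite (verts G)" "finite (edges G)" "e \<in> edges G \<Longrightarrow> size (ends G e) = 2"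
    "e \<in> edges G \<Longrightarrow> v \<in># ends G e \<Longrightarrow> v \<in> verts G" "v \<in> verts G \<Longrightarrow> degree G v = 3"
  using assms by (auto simp: cubic_graph_def fin_graph_def)

lemma proper_imp_double_cover:
  assumes G: "cubic_graph G" and c: "proper_edge_colouring (remove_verts G S) 3 c"
  shows "double_cover G (verts G - S) {e \<in> edges G. c e \<noteq> 0} {e \<in> edges G. c e \<noteq> 1}"
proof -
  let ?R = "remove_verts G S"
  have "even_at G {e \<in> edges G. c e \<noteq> i} v" if v: "v \<in> verts G - S" and i: "i < 3" for v i
  proof -
    have "even_at ?R {e \<in> edges ?R. c e \<noteq> i} v"
    proof (rule proper_imp_even_at[OF _ _ _ c i])
      show "size (ends ?R e) \<le> 2" if "e \<in> edges ?R" for e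
        using cubic_graphD(3)[OF G, of e] that size_filter_mset_lesseq[of _ "ends G e"]
        by (simp add: remove_verts_def)
      show "degree ?R v = 3" using cubic_graphD(5)[OF G, of v] v by (simp add: degree_remove_verts)
    qed (simp add: cubic_graphD(2)[OF G])
    then show ?thesis using v by (simp add: even_at_remove_verts)
  qed
  from this[of _ 0] this[of _ 1] show ?thesis by (auto simp: double_cover_def)
qed

lemma double_cover_imp_proper:
  assumes G: "cubic_graph G" and AB: "double_cover G (verts G - S) A B"
  shows "proper_edge_colouring (remove_verts G S) 3 (cover_colouring A B)"
proof -
  let ?R = "remove_verts G S"
  note at = even_imp_proper_at[of ?R A B]
  have deg: "degree ?R v = 3" "even_at ?R A v" "even_at ?R B v" if "v \<in> verts G" "v \<notin> S" for v
    using cubic_graphD(5)[OF G, of v] AB that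
    by (auto simp: degree_remove_verts even_at_remove_verts double_cover_def)
  have fin: "finite (edges ?R)" "A \<union> B = edges ?R"
    using AB cubic_graphD(2)[OF G] by (auto simp: double_cover_def)
  have inV: "v \<in> verts G" "v \<notin> S" if "e \<in> edges G" "v \<in># ends ?R e" for e v
    using cubic_graphD(4)[OF G, of e v] that by (auto simp: remove_verts_def)
  show ?thesis unfolding proper_edge_colouring_def
  proof (intro conjI ballI impI)
    fix e assume e: "e \<in> edges ?R"
    show "cover_colouring A B e < 3" by (simp add: cover_colouring_def)
    show "\<not> is_loop ?R e"
    proof
      assume "is_loop ?R e"
      then obtain v where v: "ends ?R e = {#v, v#}" by (auto simp: is_loop_def)
      then show False using at(1)[OF fin deg, of v e] inV[of e v] e by auto
    qed
  next
    fix e f assume e: "e \<in> edges ?R" "f \<in> edges ?R"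
      and "e \<noteq> f \<and> set_mset (ends ?R e) \<inter> set_mset (ends ?R f) \<noteq> {}"
    then obtain v where "e \<noteq> f" "v \<in># ends ?R e" "v \<in># ends ?R f" by auto
    then show "cover_colouring A B e \<noteq> cover_colouring A B f"
      using at(2)[OF fin deg, of v e f] inV[of e v] e by auto
  qed
qed

text \<open>Two edges conflict in \<open>G - S\<close> only at a vertex outside \<open>S\<close>, so
  properness amounts to the local parity condition at exactly those vertices, each of which keeps
  degree three.\<close>

lemma colourable_remove_verts_iff:
  assumes "cubic_graph G"
  shows "edge_colourable (remove_verts G S) 3 \<longleftrightarrow> (\<exists>A B. double_cover G (verts G - S) A B)"
  using proper_imp_double_cover[OF assms] double_cover_imp_proper[OF assms]
  unfolding edge_colourable_def by blast

lemma remove_verts_empty: "remove_verts G {} = (G :: ('v, 'e) multigraph)"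
  by (simp add: remove_verts_def)

section \<open>Parity and the handshake lemma\<close>

lemma handshake:
  assumes "fin_graph G" "A \<subseteq> edges G"
  shows "(\<Sum>v\<in>verts G. \<Sum>e\<in>A. count (ends G e) v) = 2 * card A"
proof -
  have fin: "finite (verts G)" using assms by (simp add: fin_graph_def)
  have "(\<Sum>v\<in>verts G. count (ends G e) v) = 2" if "e \<in> A" for e
  proof -
    have "set_mset (ends G e) \<subseteq> verts G" "size (ends G e) = 2"
      using assms that by (auto simp: fin_graph_def)
    moreover from this have "(\<Sum>v\<in>verts G. count (ends G e) v) = (\<Sum>v\<in>set_mset (ends G e). count (ends G e) v)"
      using fin by (intro sum.mono_neutral_right) (auto simp: count_eq_zero_iff)
    ultimately show ?thesis by (simp add: size_multiset_overloaded_eq)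
  qed
  then show ?thesis by (subst sum.swap) simp
qed

lemma even_at_last_vertex:
  assumes "fin_graph G" "A \<subseteq> edges G" "u \<in> verts G" "\<And>v. v \<in> verts G - {u} \<Longrightarrow> even_at G A v"
  shows "even_at G A u"
proof -
  have fin: "finite (verts G)" using assms by (simp add: fin_graph_def)
  have "even (\<Sum>v\<in>verts G - {u}. \<Sum>e\<in>A. count (ends G e) v)"
    using assms(4) unfolding even_at_def by (rule dvd_sum)
  moreover have "(\<Sum>v\<in>verts G. \<Sum>e\<in>A. count (ends G e) v) =
      (\<Sum>e\<in>A. count (ends G e) u) + (\<Sum>v\<in>verts G - {u}. \<Sum>e\<in>A. count (ends G e) v)"
    by (rule sum.remove[OF fin assms(3)])
  moreover have "even (\<Sum>v\<in>verts G. \<Sum>e\<in>A. count (ends G e) v)"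
    unfolding handshake[OF assms(1,2)] by (rule dvd_triv_left)
  ultimately show ?thesis unfolding even_at_def by (simp only: even_add)
qed

text \<open>Once one of the two vertices is known to be even, the other is the last vertex.\<close>

lemma even_at_last_two:
  assumes "fin_graph G" "A \<subseteq> edges G" "u \<in> verts G" "v \<in> verts G" "u \<noteq> v"
    "\<And>w. w \<in> verts G - {u, v} \<Longrightarrow> even_at G A w"
  shows "even_at G A u \<longleftrightarrow> even_at G A v"
proof -
  have "even_at G A v" if "even_at G A u"
    by (rule even_at_last_vertex[OF assms(1,2)]) (use that assms in auto)
  moreover have "even_at G A u" if "even_at G A v"
    by (rule even_at_last_vertex[OF assms(1,2)]) (use that assms in auto)
  ultimately show ?thesis by blast
qed

subsection \<open>Nowhere-zero 4-flows\<close>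

lemma size_two_multiset:
  assumes "size M = 2" "v \<in># M" obtains x where "M = {#v, x#}"
proof -
  obtain N where N: "M = add_mset v N" using assms(2) by (meson multi_member_split)
  then have "size N = 1" using assms(1) by simp
  then obtain x where "N = {#x#}" using size_1_singleton_mset by blast
  with N that show thesis by simp
qed

lemma size_two_cases:
  assumes "size M = 2" obtains x y where "M = {#x, y#}"
proof -
  obtain x where "x \<in># M" using assms by fastforce
  then show thesis using size_two_multiset[OF assms] that by metis
qed

lemma pair_mset_eq_iff: "{#a, b#} = {#c, d#} \<longleftrightarrow> a = c \<and> b = d \<or> a = d \<and> b = c"
  by (auto simp: add_eq_conv_diff)

text \<open>Induction on the number of edges. A loop is balanced by itself and can be removed;
  otherwise two edges meeting at a vertex are replaced by one edge that bypasses it. The new edge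
  may be a loop, and the function \<open>en\<close> changes, so it is generalised in the
  induction.\<close>

lemma eulerian_orientation:
  fixes en :: "'e \<Rightarrow> 'v multiset"
  assumes "finite A" "\<And>e. e \<in> A \<Longrightarrow> size (en e) = 2" "\<And>v. even (\<Sum>e\<in>A. count (en e) v)"
  shows "\<exists>t h. (\<forall>e\<in>A. en e = {#t e, h e#}) \<and>
    (\<forall>v. (\<Sum>e\<in>A. of_bool (h e = v) - of_bool (t e = v) :: int) = 0)"
  using assms
proof (induction "card A" arbitrary: A en rule: less_induct)
  case less
  note fin = less.prems(1) and sz = less.prems(2) and ev = less.prems(3)
  consider "A = {}" | (loop) e x where "e \<in> A" "en e = {#x, x#}"
    | (no_loop) e where "e \<in> A" "\<And>f x. f \<in> A \<Longrightarrow> en f \<noteq> {#x, x#}" by blast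
  then show ?case
  proof cases
    case loop
    have "even (\<Sum>f\<in>A - {e}. count (en f) v)" for v
      using ev[of v] loop sum.remove[OF fin loop(1), of "\<lambda>f. count (en f) v"]
      by (auto split: if_splits)
    then obtain t h where th: "\<And>f. f \<in> A - {e} \<Longrightarrow> en f = {#t f, h f#}"
      "\<And>v. (\<Sum>f\<in>A - {e}. of_bool (h f = v) - of_bool (t f = v) :: int) = 0"
      using less.hyps[of "A - {e}" en] fin sz card_Diff1_less[OF fin loop(1)] by auto
    let ?t = "t(e := x)" and ?h = "h(e := x)"
    have "(\<Sum>f\<in>A. of_bool (?h f = v) - of_bool (?t f = v) :: int) = 0" for v
    proof -
      have "(\<Sum>f\<in>A - {e}. of_bool (?h f = v) - of_bool (?t f = v) :: int) =
          (\<Sum>f\<in>A - {e}. of_bool (h f = v) - of_bool (t f = v))"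
        by (rule sum.cong) auto
      then show ?thesis
        using th(2)[of v] sum.remove[OF fin loop(1), of "\<lambda>f. of_bool (?h f = v) - of_bool (?t f = v) :: int"]
        by simp
    qed
    moreover have "\<forall>f\<in>A. en f = {#?t f, ?h f#}" using th(1) loop(2) by auto
    ultimately show ?thesis by blast
  next
    case no_loop
    obtain a where a: "a \<in># en e" using sz[OF no_loop(1)] by fastforce
    obtain v where "en e = {#a, v#}" using size_two_multiset[OF sz[OF no_loop(1)] a] .
    then obtain x where e: "en e = {#x, v#}" "x \<noteq> v" using no_loop by (metis add_mset_commute)
    \<comment> \<open>The non-loop \<open>e\<close> contributes one at \<open>v\<close>, so an even
      total requires another edge there.\<close>
    have "\<exists>e'\<in>A - {e}. v \<in># en e'"
    proof (rule ccontr)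
      assume "\<not> ?thesis"
      then have "(\<Sum>f\<in>A - {e}. count (en f) v) = 0"
        by (intro sum.neutral) (auto simp: count_eq_zero_iff)
      then show False
        using ev[of v] e sum.remove[OF fin no_loop(1), of "\<lambda>f. count (en f) v"] by simp
    qed
    then obtain e' where e': "e' \<in> A" "e' \<noteq> e" "v \<in># en e'" by auto
    obtain y where y: "en e' = {#v, y#}" using size_two_multiset[OF sz[OF e'(1)] e'(3)] .
    with no_loop e' have "y \<noteq> v" by auto
    define R where "R = A - {e, e'}"
    have R: "finite R" "A = insert e (insert e' R)" "e \<notin> R" "e' \<notin> R" "A - {e'} = insert e R"
      using fin no_loop(1) e' by (auto simp: R_def)
    \<comment> \<open>Split the path \<open>x v y\<close> off \<open>v\<close>: the two edges are replaced by a single edge \<open>x y\<close>.\<close>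
    let ?en = "en(e := {#x, y#})"
    have "even (\<Sum>f\<in>insert e R. count (?en f) w)" for w
    proof -
      have "(\<Sum>f\<in>R. count (?en f) w) = (\<Sum>f\<in>R. count (en f) w)"
        using R by (intro sum.cong) auto
      then show ?thesis using ev[of w] R e e' y by (auto split: if_splits)
    qed
    moreover have "card (insert e R) < card A" using R e'(2) by simp
    moreover have "size (?en f) = 2" if "f \<in> insert e R" for f using that sz R by auto
    ultimately obtain t h where th: "\<And>f. f \<in> insert e R \<Longrightarrow> ?en f = {#t f, h f#}"
      "\<And>w. (\<Sum>f\<in>insert e R. of_bool (h f = w) - of_bool (t f = w) :: int) = 0"
      using less.hyps[of "insert e R" ?en] R(1) by blast
    \<comment> \<open>The direction of the merged edge is transferred to the path through
      \<open>v\<close>, in the order \<open>x\<close>, \<open>v\<close>, \<open>y\<close> or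
      reversed. The path enters and leaves \<open>v\<close> once, so its net contribution is that of
      the merged edge everywhere.\<close>
    have "\<exists>p q p' q'. en e = {#p, q#} \<and> en e' = {#p', q'#} \<and>
        (\<forall>w. of_bool (q = w) - of_bool (p = w) + (of_bool (q' = w) - of_bool (p' = w)) =
          (of_bool (h e = w) - of_bool (t e = w) :: int))"
    proof -
      have "{#x, y#} = {#t e, h e#}" using th(1)[of e] by simp
      then consider "t e = x" "h e = y" | "t e = y" "h e = x"
        by (auto simp: pair_mset_eq_iff)
      then show ?thesis
      proof cases
        case 1
        then show ?thesis using e y by (intro exI[of _ x] exI[of _ v] exI[of _ y]) auto
      next
        case 2
        then show ?thesis using e y
          by (intro exI[of _ v] exI[of _ x] exI[of _ y]) (auto simp: add_mset_commute)
      qed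
    qed
    then obtain p q p' q' where pq: "en e = {#p, q#}" "en e' = {#p', q'#}"
      "\<And>w. of_bool (q = w) - of_bool (p = w) + (of_bool (q' = w) - of_bool (p' = w)) =
          (of_bool (h e = w) - of_bool (t e = w) :: int)" by blast
    let ?t = "t(e := p, e' := p')" and ?h = "h(e := q, e' := q')"
    have "(\<Sum>f\<in>A. of_bool (?h f = w) - of_bool (?t f = w) :: int) = 0" for w
    proof -
      have "(\<Sum>f\<in>R. of_bool (?h f = w) - of_bool (?t f = w) :: int) =
          (\<Sum>f\<in>R. of_bool (h f = w) - of_bool (t f = w))"
        using R by (intro sum.cong) auto
      moreover have "(\<Sum>f\<in>A. of_bool (?h f = w) - of_bool (?t f = w) :: int) =
        of_bool (q = w) - of_bool (p = w) + (of_bool (q' = w) - of_bool (p' = w))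
          + (\<Sum>f\<in>R. of_bool (?h f = w) - of_bool (?t f = w) :: int)"
        unfolding R(2) using R(1,3,4) e'(2) by simp
      moreover have "(\<Sum>f\<in>insert e R. of_bool (h f = w) - of_bool (t f = w) :: int) =
         (of_bool (h e = w) - of_bool (t e = w)) + (\<Sum>f\<in>R. of_bool (h f = w) - of_bool (t f = w))"
        using R(1,3) by simp
      ultimately show ?thesis using th(2)[of w] pq(3)[of w] by linarith
    qed
    moreover have "\<forall>f\<in>A. en f = {#?t f, ?h f#}"
    proof
      fix f assume "f \<in> A"
      then consider "f = e" | "f = e'" | "f \<in> R" using R(2) by auto
      then show "en f = {#?t f, ?h f#}"
        using th(1)[of f] pq R e'(2) by cases auto
    qed
    ultimately show ?thesis by blast
  qed simp
qed

text \<open>The balanced orientation of \<open>A\<close> is compared with the given one by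
  \<open>T\<close> and \<open>H\<close>: the sign is \<open>1\<close> where they agree and
  \<open>-1\<close> where they are opposite. For a loop both readings contribute zero.\<close>

lemma signed_flow_of_even:
  fixes T H :: "'e \<Rightarrow> 'v"
  assumes fin: "finite E" and A: "A \<subseteq> E" and en: "\<And>e. e \<in> E \<Longrightarrow> en e = {#T e, H e#}"
    and ev: "\<And>v. even (\<Sum>e\<in>A. count (en e) v)"
  obtains s :: "'e \<Rightarrow> int" where "\<And>e. e \<in> A \<Longrightarrow> s e = 1 \<or> s e = -1" "\<And>e. e \<notin> A \<Longrightarrow> s e = 0"
    "\<And>v. (\<Sum>e\<in>E. s e * (of_bool (H e = v) - of_bool (T e = v))) = 0"
proof -
  have "finite A" using fin A finite_subset by blast
  then obtain t h where th: "\<And>e. e \<in> A \<Longrightarrow> en e = {#t e, h e#}"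
    "\<And>v. (\<Sum>e\<in>A. of_bool (h e = v) - of_bool (t e = v) :: int) = 0"
    using eulerian_orientation[of A en] ev en A by force
  define s :: "'e \<Rightarrow> int" where "s e = (if e \<in> A then if t e = T e then 1 else -1 else 0)" for e
  have "(\<Sum>e\<in>E. s e * (of_bool (H e = v) - of_bool (T e = v))) = 0" for v
  proof -
    have "(\<Sum>e\<in>E. s e * (of_bool (H e = v) - of_bool (T e = v))) =
        (\<Sum>e\<in>A. s e * (of_bool (H e = v) - of_bool (T e = v)))"
      using fin A by (intro sum.mono_neutral_right) (auto simp: s_def)
    also have "\<dots> = (\<Sum>e\<in>A. of_bool (h e = v) - of_bool (t e = v))"
    proof (rule sum.cong)
      fix e assume e: "e \<in> A"
      then have "{#t e, h e#} = {#T e, H e#}" using th(1)[of e] en[of e] A by auto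
      then have "t e = T e \<and> h e = H e \<or> t e = H e \<and> h e = T e"
        by (simp add: pair_mset_eq_iff)
      then show "s e * (of_bool (H e = v) - of_bool (T e = v)) = of_bool (h e = v) - of_bool (t e = v)"
        using e by (auto simp: s_def)
    qed simp
    finally show ?thesis using th(2) by simp
  qed
  then show thesis using that[of s] by (auto simp: s_def)
qed

text \<open>A single signed sum over all edges is linear in \<open>f\<close>, so flows can be added,
  subtracted and halved.\<close>

lemma conservation_iff:
  fixes f :: "'e \<Rightarrow> int"
  assumes "finite E"
  shows "(\<Sum>e | e \<in> E \<and> H e = v. f e) = (\<Sum>e | e \<in> E \<and> T e = v. f e) \<longleftrightarrow>
    (\<Sum>e\<in>E. f e * (of_bool (H e = v) - of_bool (T e = v))) = 0"
proof -
  have "(\<Sum>e | e \<in> E \<and> P e. f e) = (\<Sum>e\<in>E. f e * of_bool (P e))" for P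
    using assms by (intro sum.mono_neutral_cong_left) auto
  then show ?thesis by (simp add: right_diff_distrib sum_subtractf)
qed

text \<open>Modulo two signs disappear, so the net flow at \<open>v\<close> is congruent to the
  number of incidences of odd edges there.\<close>

lemma even_support_of_conserved:
  fixes f :: "'e \<Rightarrow> int"
  assumes "finite E" "\<And>e. e \<in> E \<Longrightarrow> en e = {#T e, H e#}"
    and "(\<Sum>e\<in>E. f e * (of_bool (H e = v) - of_bool (T e = v))) = 0"
  shows "even (\<Sum>e | e \<in> E \<and> odd (f e). count (en e) v)"
proof -
  have "int (\<Sum>e | e \<in> E \<and> odd (f e). count (en e) v) =
      (\<Sum>e\<in>E. of_bool (odd (f e)) * (of_bool (H e = v) + of_bool (T e = v)))"
    unfolding of_nat_sum using assms(1,2) by (intro sum.mono_neutral_cong_left) auto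
  \<comment> \<open>Subtracting the net flow, which is zero, makes every single summand
    even.\<close>
  also have "\<dots> = (\<Sum>e\<in>E. of_bool (odd (f e)) * (of_bool (H e = v) + of_bool (T e = v))
      - f e * (of_bool (H e = v) - of_bool (T e = v)))"
    using assms(3) by (simp add: sum_subtractf)
  finally have "int (\<Sum>e | e \<in> E \<and> odd (f e). count (en e) v) = \<dots>" .
  moreover have "even \<dots>" by (intro dvd_sum) auto
  ultimately show ?thesis by (metis even_of_nat_iff)
qed

text \<open>From a flow \<open>f\<close>, \<open>A\<close> is its odd support; removing a signed
  flow on \<open>A\<close>, halving and taking odd supports again gives \<open>B\<close>. An edge
  outside both would carry a multiple of four, hence zero. Conversely, signed flows \<open>a\<close>
  on \<open>A\<close> and \<open>b\<close> on \<open>B\<close> combine to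
  \<open>a + 2 b\<close>.\<close>

lemma nowhere_zero_flow_iff:
  fixes G :: "('v, 'e) multigraph"
  assumes G: "fin_graph G"
  shows "nowhere_zero_flow G 4 \<longleftrightarrow> (\<exists>A B. double_cover G (verts G) A B)"
proof
  have fin: "finite (edges G)" using G by (simp add: fin_graph_def)
  assume "nowhere_zero_flow G 4"
  then obtain T H and f :: "'e \<Rightarrow> int" where
    f0: "\<forall>e\<in>edges G. ends G e = {#T e, H e#} \<and> f e \<noteq> 0 \<and> \<bar>f e\<bar> < int 4" and
    flow: "\<forall>v\<in>verts G. (\<Sum>e | e \<in> edges G \<and> H e = v. f e) = (\<Sum>e | e \<in> edges G \<and> T e = v. f e)"
    unfolding nowhere_zero_flow_def by (elim exE conjE)
  have en: "ends G e = {#T e, H e#}" and f: "f e \<noteq> 0 \<and> \<bar>f e\<bar> < 4" if "e \<in> edges G" for e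
    using f0 that by auto
  \<comment> \<open>Conservation is extended to all elements of the vertex type, since no edge ends
    outside \<open>verts G\<close>; the evenness conditions for orientations are stated in that
    form.\<close>
  have flow': "(\<Sum>e\<in>edges G. f e * (of_bool (H e = v) - of_bool (T e = v))) = 0" for v
  proof (cases "v \<in> verts G")
    case True
    then show ?thesis
      using flow by (simp add: conservation_iff[OF fin, where H = H and T = T and f = f and v = v, symmetric])
  next
    case False
    then have "H e \<noteq> v \<and> T e \<noteq> v" if "e \<in> edges G" for e
      using G en[OF that] that by (force simp: fin_graph_def)
    then show ?thesis by (intro sum.neutral) auto
  qed
  define A where "A = {e \<in> edges G. odd (f e)}"
  have AE: "A \<subseteq> edges G" by (auto simp: A_def)
  have A: "even (\<Sum>e\<in>A. count (ends G e) v)" for v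
    unfolding A_def by (rule even_support_of_conserved[OF fin en flow'])
  obtain s :: "'e \<Rightarrow> int" where s: "\<And>e. e \<in> A \<Longrightarrow> s e = 1 \<or> s e = -1" "\<And>e. e \<notin> A \<Longrightarrow> s e = 0"
    "\<And>v. (\<Sum>e\<in>edges G. s e * (of_bool (H e = v) - of_bool (T e = v))) = 0"
    using signed_flow_of_even[OF fin AE en A] by blast
  \<comment> \<open>\<open>f\<close> and \<open>s\<close> agree modulo 2, and the second even set is read off half their difference.\<close>
  define g where "g e = (f e - s e) div 2" for e
  have g: "f e - s e = 2 * g e" if "e \<in> edges G" for e
  proof -
    have "even (f e - s e)" using s(1,2)[of e] that by (cases "e \<in> A") (auto simp: A_def)
    then show ?thesis by (simp add: g_def)
  qed
  have flowg: "(\<Sum>e\<in>edges G. g e * (of_bool (H e = v) - of_bool (T e = v))) = 0" for v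
  proof -
    have "2 * (\<Sum>e\<in>edges G. g e * (of_bool (H e = v) - of_bool (T e = v))) =
       (\<Sum>e\<in>edges G. (f e - s e) * (of_bool (H e = v) - of_bool (T e = v)))"
      unfolding sum_distrib_left by (intro sum.cong) (auto simp: g)
    also have "\<dots> = 0"
      unfolding left_diff_distrib sum_subtractf using s(3)[of v] flow'[of v] by simp
    finally show ?thesis by simp
  qed
  define B where "B = {e \<in> edges G. odd (g e)}"
  have B: "even (\<Sum>e\<in>B. count (ends G e) v)" for v
    unfolding B_def by (rule even_support_of_conserved[OF fin en flowg])
  have "e \<in> B" if "e \<in> edges G" "e \<notin> A" for e
  proof (rule ccontr)
    assume "e \<notin> B"
    then have "even (g e)" using that(1) by (simp add: B_def)
    then obtain k where "g e = 2 * k" by (rule evenE)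
    then have "f e = 4 * k" using g[OF that(1)] s(2)[OF that(2)] by simp
    then show False using f[OF that(1)] by (cases "k = 0") auto
  qed
  then have "double_cover G (verts G) A B"
    using A B by (auto simp: double_cover_def even_at_def A_def B_def)
  then show "\<exists>A B. double_cover G (verts G) A B" by blast
next
  have fin: "finite (edges G)" using G by (simp add: fin_graph_def)
  assume "\<exists>A B. double_cover G (verts G) A B"
  then obtain A B where AB: "A \<union> B = edges G" "\<And>v. v \<in> verts G \<Longrightarrow> even_at G A v \<and> even_at G B v"
    by (auto simp: double_cover_def)
  have "\<exists>p. ends G e = {#fst p, snd p#}" if "e \<in> edges G" for e
  proof -
    have "size (ends G e) = 2" using G that by (simp add: fin_graph_def)
    then obtain v where "v \<in># ends G e" by fastforce
    with \<open>size (ends G e) = 2\<close> show ?thesis by (metis fst_conv snd_conv size_two_multiset)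
  qed
  then obtain p where p: "\<And>e. e \<in> edges G \<Longrightarrow> ends G e = {#fst (p e), snd (p e)#}" by metis
  define T H where "T e = fst (p e)" and "H e = snd (p e)" for e
  have en: "\<And>e. e \<in> edges G \<Longrightarrow> ends G e = {#T e, H e#}" using p by (simp add: T_def H_def)
  have ev: "even (\<Sum>e\<in>X. count (ends G e) v)" if "X = A \<or> X = B" for X v
  proof (cases "v \<in> verts G")
    case True
    then show ?thesis using AB(2)[of v] that by (auto simp: even_at_def)
  next
    case False
    then have "count (ends G e) v = 0" if "e \<in> edges G" for e
      using G that by (auto simp: fin_graph_def count_eq_zero_iff)
    then have "(\<Sum>e\<in>X. count (ends G e) v) = 0" using AB(1) that by (intro sum.neutral) auto
    then show ?thesis by simp
  qed
  have sub: "A \<subseteq> edges G" "B \<subseteq> edges G" and ev': "\<And>v. even (\<Sum>e\<in>A. count (ends G e) v)"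
    "\<And>v. even (\<Sum>e\<in>B. count (ends G e) v)" using AB(1) ev by auto
  obtain a :: "'e \<Rightarrow> int" where a: "\<And>e. e \<in> A \<Longrightarrow> a e = 1 \<or> a e = -1" "\<And>e. e \<notin> A \<Longrightarrow> a e = 0"
    "\<And>v. (\<Sum>e\<in>edges G. a e * (of_bool (H e = v) - of_bool (T e = v))) = 0"
    using signed_flow_of_even[OF fin sub(1) en ev'(1)] by blast
  obtain b :: "'e \<Rightarrow> int" where b: "\<And>e. e \<in> B \<Longrightarrow> b e = 1 \<or> b e = -1" "\<And>e. e \<notin> B \<Longrightarrow> b e = 0"
    "\<And>v. (\<Sum>e\<in>edges G. b e * (of_bool (H e = v) - of_bool (T e = v))) = 0"
    using signed_flow_of_even[OF fin sub(2) en ev'(2)] by blast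
  \<comment> \<open>The value is 1 or -1 on \<open>A\<close> alone, 2 or -2 on \<open>B\<close>
    alone, and odd of absolute value 1 or 3 on both.\<close>
  define f where "f e = a e + 2 * b e" for e
  have "(\<Sum>e\<in>edges G. f e * (of_bool (H e = v) - of_bool (T e = v))) = 0" for v
  proof -
    have "(\<Sum>e\<in>edges G. f e * (of_bool (H e = v) - of_bool (T e = v))) =
      (\<Sum>e\<in>edges G. a e * (of_bool (H e = v) - of_bool (T e = v))) +
      2 * (\<Sum>e\<in>edges G. b e * (of_bool (H e = v) - of_bool (T e = v)))"
      unfolding sum_distrib_left sum.distrib[symmetric] by (intro sum.cong) (auto simp: f_def algebra_simps)
    then show ?thesis using a(3) b(3) by simp
  qed
  then have "\<forall>v\<in>verts G. (\<Sum>e | e \<in> edges G \<and> H e = v. f e) = (\<Sum>e | e \<in> edges G \<and> T e = v. f e)"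
    by (simp add: conservation_iff[OF fin, where H = H and T = T and f = f])
  moreover have "f e \<noteq> 0 \<and> \<bar>f e\<bar> < int 4" if "e \<in> edges G" for e
  proof -
    have "e \<in> A \<or> e \<in> B" using that AB(1) by auto
    then show ?thesis
      using a(1,2)[of e] b(1,2)[of e] by (cases "e \<in> A"; cases "e \<in> B") (auto simp: f_def)
  qed
  ultimately show "nowhere_zero_flow G 4"
    unfolding nowhere_zero_flow_def using en by (intro exI[of _ T] exI[of _ H] exI[of _ f]) auto
qed

section \<open>Identification of two vertices\<close>

lemma count_identify:
  assumes "u \<noteq> v" "w \<noteq> v"
  shows "count (ends (identify G u v) e) w =
    (if w = u then count (ends G e) u + count (ends G e) v else count (ends G e) w)"
proof -
  have "count (image_mset (\<lambda>x. if x = v then u else x) M) w =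
    (if w = u then count M u + count M v else count M w)" for M
    using assms by (induction M) auto
  then show ?thesis by (simp add: identify_def)
qed

lemma fin_graph_identify:
  assumes "fin_graph G" "u \<in> verts G" "u \<noteq> v"
  shows "fin_graph (identify G u v)"
  using assms by (auto simp: fin_graph_def identify_def)

text \<open>Parities at vertices other than \<open>u\<close> and \<open>v\<close> do not change
  under identification. At the merged vertex, still called \<open>u\<close>, conservation is
  automatic because it is the only vertex left.\<close>

lemma identify_flow_iff_colourable:
  assumes G: "cubic_graph G" and uv: "u \<in> verts G" "u \<noteq> v"
  shows "nowhere_zero_flow (identify G u v) 4 \<longleftrightarrow> edge_colourable (remove_verts G {u, v}) 3"
proof -
  let ?I = "identify G u v"
  have fin: "fin_graph ?I" using G uv by (simp add: fin_graph_identify cubic_graph_def)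
  have [simp]: "verts ?I = verts G - {v}" "edges ?I = edges G" by (simp_all add: identify_def)
  have at: "even_at ?I A w = even_at G A w" if "w \<in> verts G - {u, v}" for A w
    using that uv(2) by (simp add: even_at_def count_identify)
  have "double_cover ?I (verts ?I) A B \<longleftrightarrow> double_cover G (verts G - {u, v}) A B" for A B
  proof
    assume "double_cover ?I (verts ?I) A B"
    then show "double_cover G (verts G - {u, v}) A B"
      using at by (auto simp: double_cover_def)
  next
    assume *: "double_cover G (verts G - {u, v}) A B"
    then have sub: "A \<subseteq> edges G" "B \<subseteq> edges G" by (auto simp: double_cover_def)
    have "even_at ?I A w \<and> even_at ?I B w" if "w \<in> verts G - {u, v}" for w
      using * at[OF that] that by (auto simp: double_cover_def)
    moreover from this have "even_at ?I A u" "even_at ?I B u"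
      using sub uv even_at_last_vertex[OF fin, of A u] even_at_last_vertex[OF fin, of B u] by auto
    ultimately show "double_cover ?I (verts ?I) A B"
      using * unfolding double_cover_def by auto
  qed
  then show ?thesis
    unfolding nowhere_zero_flow_iff[OF fin] colourable_remove_verts_iff[OF G] by blast
qed

lemma critical_iff_four_edge_critical:
  assumes "cubic_graph G"
  shows "critical G \<longleftrightarrow> four_edge_critical G"
  unfolding critical_def four_edge_critical_def
proof (intro ball_cong refl imp_cong)
  fix u v assume "u \<in> verts G" "adjacent G u v"
  then show "edge_colourable (remove_verts G {u, v}) 3 = nowhere_zero_flow (identify G u v) 4"
    using identify_flow_iff_colourable[OF assms, of u v] by (simp add: adjacent_def)
qed

subsection \<open>Suppression\<close>

definition merge_rel :: "('v, 'e) multigraph \<Rightarrow> 'v set \<Rightarrow> ('e \<times> 'e) set" where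
  "merge_rel G S = {(a, b). a \<in> edges G \<and> b \<in> edges G \<and> set_mset (ends G a) \<inter> set_mset (ends G b) \<inter> S \<noteq> {}}"

lemma suppress_simps:
  "verts (suppress G S) = verts G - S"
  "edges (suppress G S) = edges G // (merge_rel G S)\<^sup>*"
  "ends (suppress G S) K = (\<Sum>a\<in>K. filter_mset (\<lambda>x. x \<notin> S) (ends G a))"
  by (simp_all add: suppress_def merge_rel_def)

lemma merge_rel_sym: "sym ((merge_rel G S)\<^sup>*)"
  by (rule sym_rtrancl, rule symI) (simp add: merge_rel_def Int_commute)

text \<open>Classes are bounded from above this way: any set closed under merging contains the class
  of each of its elements.\<close>

lemma merge_class_closed:
  assumes "(a, b) \<in> (merge_rel G S)\<^sup>*" "a \<in> X"
    and closed: "\<And>x y. x \<in> X \<Longrightarrow> (x, y) \<in> merge_rel G S \<Longrightarrow> y \<in> X"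
  shows "b \<in> X"
  using assms(1,2) by (induction rule: rtrancl_induct) (simp, blast intro: closed)

lemma merge_class_subset:
  assumes "a \<in> edges G" shows "(merge_rel G S)\<^sup>* `` {a} \<subseteq> edges G"
proof
  fix b assume "b \<in> (merge_rel G S)\<^sup>* `` {a}"
  then have "(a, b) \<in> (merge_rel G S)\<^sup>*" by simp
  from this assms show "b \<in> edges G"
    by (rule merge_class_closed) (simp add: merge_rel_def)
qed

lemma in_ends_suppress:
  assumes "finite (edges G)" "K \<subseteq> edges G"
  shows "w \<in># ends (suppress G S) K \<longleftrightarrow> w \<notin> S \<and> (\<exists>a\<in>K. w \<in># ends G a)"
proof -
  have "finite K" using assms finite_subset by blast
  then show ?thesis by (auto simp: suppress_simps set_mset_sum)
qed

lemma delete_edges_simps [simp]: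
  "verts (delete_edges G F) = verts G" "edges (delete_edges G F) = edges G - F"
  "ends (delete_edges G F) = ends G"
  by (simp_all add: delete_edges_def)

text \<open>The non-loop \<open>e\<close> takes one from the degree of each of its ends and nothing
  elsewhere, so exactly \<open>u\<close> and \<open>v\<close> drop from three to two.\<close>

lemma delete_suppress_eq:
  assumes G: "cubic_graph G" and e: "e \<in> edges G" "ends G e = {#u, v#}" "u \<noteq> v"
  shows "delete_suppress G e = suppress (delete_edges G {e}) {u, v}"
    and "\<And>w. w \<in> {u, v} \<Longrightarrow> degree (delete_edges G {e}) w = 2"
proof -
  let ?D = "delete_edges G {e}"
  have uvV: "u \<in> verts G" "v \<in> verts G" using cubic_graphD(4)[OF G e(1)] e(2) by auto
  have deg: "degree ?D w + count (ends G e) w = degree G w" for w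
    using sum.remove[OF cubic_graphD(2)[OF G] e(1), of "\<lambda>f. count (ends G f) w"]
    by (simp add: degree_def delete_edges_def)
  have d: "degree ?D w = (if w \<in> {u, v} then 2 else 3)" if "w \<in> verts G" for w
    using cubic_graphD(5)[OF G that] deg[of w] e(3) unfolding e(2) by (auto split: if_splits)
  then have "{w \<in> verts ?D. degree ?D w = 2} = {u, v}"
    using uvV by (auto simp: delete_edges_def split: if_splits)
  then show "delete_suppress G e = suppress (delete_edges G {e}) {u, v}"
    by (simp add: delete_suppress_def)
  show "degree ?D w = 2" if "w \<in> {u, v}" for w using d uvV that by auto
qed

lemma even_at_insert:
  assumes "finite X" "e \<notin> X"
  shows "even_at G (insert e X) w \<longleftrightarrow> (even (count (ends G e) w) \<longleftrightarrow> even_at G X w)"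
  using assms by (simp add: even_at_def)

text \<open>Here the uncolourability of \<open>G\<close> enters: a defect of \<open>A\<close> or
  \<open>B\<close> at \<open>u\<close> or \<open>v\<close> would provide a nonzero value for
  \<open>e\<close> and extend the cover to all vertices of \<open>G\<close>.\<close>

lemma even_at_without_edge:
  assumes "\<not> edge_colourable G 3" and G: "cubic_graph G"
    and e: "e \<in> edges G" "ends G e = {#u, v#}" "u \<noteq> v"
    and cov: "double_cover G (verts G - {u, v}) A B" and w: "w \<in> {u, v}"
  shows "even_at G (A - {e}) w \<and> even_at G (B - {e}) w"
proof (rule ccontr)
  assume neg: "\<not> ?thesis"
  have fin: "fin_graph G" using G by (simp add: cubic_graph_def)
  have uvV: "u \<in> verts G" "v \<in> verts G" using cubic_graphD(4)[OF G e(1)] e(2) by auto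
  have sub: "A \<subseteq> edges G" "B \<subseteq> edges G" "A \<union> B = edges G" using cov by (auto simp: double_cover_def)
  have finX: "finite X" if "X \<subseteq> edges G" for X using cubic_graphD(2)[OF G] that finite_subset by blast
  have off: "even_at G (X - {e}) x \<longleftrightarrow> even_at G X x" if "x \<notin> {u, v}" "X \<subseteq> edges G" for X x
    using that e even_at_insert[of "X - {e}" e G x] finX[of X]
    by (cases "e \<in> X") (auto simp: insert_absorb)
  have on: "even_at G (insert e (X - {e})) x \<longleftrightarrow> \<not> even_at G (X - {e}) x"
    if "x \<in> {u, v}" "X \<subseteq> edges G" for X x
    using that e by (subst even_at_insert) (auto simp: finX)
  have ev: "even_at G X x" if "X = A \<or> X = B" "x \<in> verts G - {u, v}" for X x
    using cov that by (auto simp: double_cover_def)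
  have same: "even_at G (X - {e}) u \<longleftrightarrow> even_at G (X - {e}) v" if X: "X = A \<or> X = B" for X
  proof (rule even_at_last_two[OF fin _ uvV e(3)])
    show "even_at G (X - {e}) y" if "y \<in> verts G - {u, v}" for y
      using off[of y X] sub ev[OF X that] that X by auto
  qed (use X sub in auto)
  \<comment> \<open>Choosing the value of \<open>e\<close> afresh balances \<open>u\<close> and \<open>v\<close> simultaneously; if that value is
    nonzero, all of \<open>G\<close> is coloured.\<close>
  define fix_up where "fix_up X = (if even_at G (X - {e}) u then X - {e} else insert e (X - {e}))" for X
  have fixed: "even_at G (fix_up X) x" if X: "X = A \<or> X = B" and x: "x \<in> verts G" for X x
  proof -
    have Xs: "X \<subseteq> edges G" using X sub by auto
    show ?thesis
    proof (cases "x \<in> {u, v}")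
      case True
      then show ?thesis using same[OF X] on[OF True Xs] by (auto simp: fix_up_def)
    next
      case False
      have "insert e (X - {e}) - {e} = X - {e}" by auto
      then have "even_at G (insert e (X - {e})) x \<longleftrightarrow> even_at G (X - {e}) x"
        using off[OF False, of "insert e (X - {e})"] Xs e(1) by auto
      then show ?thesis using off[OF False Xs] ev[OF X, of x] x False by (auto simp: fix_up_def)
    qed
  qed
  \<comment> \<open>By \<open>neg\<close>, one of the sets has a defect at \<open>w\<close>; by
    \<open>same\<close> it also has one at \<open>u\<close>, the vertex tested by
    \<open>fix_up\<close>.\<close>
  have e_in: "e \<in> fix_up A \<union> fix_up B"
    using neg w same[of A] same[of B] by (auto simp: fix_up_def)
  have "fix_up A \<union> fix_up B = edges G"
    using sub e_in e(1) by (auto simp: fix_up_def split: if_splits)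
  then have "double_cover G (verts G) (fix_up A) (fix_up B)"
    using fixed by (auto simp: double_cover_def)
  then have "edge_colourable (remove_verts G {}) 3"
    using colourable_remove_verts_iff[OF G, of "{}"] by auto
  then show False using assms(1) by (simp add: remove_verts_empty)
qed

text \<open>With \<open>e\<close> ignored, both sets are even at \<open>u\<close> and at
  \<open>v\<close>, so the two remaining incidences at such a vertex have equal colours. The
  colouring is therefore constant on merge classes and descends to them.\<close>

lemma colourable_delete_suppress:
  assumes unc: "\<not> edge_colourable G 3" and G: "cubic_graph G"
    and e: "e \<in> edges G" "ends G e = {#u, v#}" "u \<noteq> v"
    and col: "edge_colourable (remove_verts G {u, v}) 3"
  shows "edge_colourable (delete_suppress G e) 3"
proof -
  define S where "S = {u, v}"
  let ?D = "delete_edges G {e}" and ?R = "remove_verts G S"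
  let ?r = "(merge_rel ?D S)\<^sup>*"
  have finD: "finite (edges ?D)" using cubic_graphD(2)[OF G] by simp
  obtain c where c: "proper_edge_colouring ?R 3 c" using col by (auto simp: edge_colourable_def S_def)
  let ?A = "{f \<in> edges G. c f \<noteq> 0}" and ?B = "{f \<in> edges G. c f \<noteq> 1}"
  have c3: "c f < 3" if "f \<in> edges G" for f using c that by (simp add: proper_edge_colouring_def)
  have cov: "double_cover G (verts G - {u, v}) ?A ?B"
    using proper_imp_double_cover[OF G c] by (simp add: S_def)
  have step: "c a = c b" if ab: "(a, b) \<in> merge_rel ?D S" for a b
  proof -
    obtain w where w: "w \<in> S" "w \<in># ends G a" "w \<in># ends G b" and
      aE: "a \<in> edges G - {e}" and bE: "b \<in> edges G - {e}"
      using ab by (auto simp: merge_rel_def)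
    have "size (incidences ?D w) = 2"
      using delete_suppress_eq(2)[OF G e, of w] w(1) by (simp add: size_incidences S_def)
    then obtain x y where xy: "incidences ?D w = {#x, y#}" using size_two_cases by blast
    have mem: "f \<in> {x, y} \<longleftrightarrow> f \<in> edges G - {e} \<and> w \<in># ends G f" for f
      using in_incidences[OF finD, of f w] by (auto simp: xy)
    have "even_at G (?A - {e}) w \<and> even_at G (?B - {e}) w"
      using even_at_without_edge[OF unc G e cov, of w] w(1) by (simp add: S_def)
    moreover have "even_at G X w = even_at ?D X w" for X by (simp add: even_at_def)
    moreover have "?A - {e} \<subseteq> edges ?D" "?B - {e} \<subseteq> edges ?D" by auto
    ultimately have ev: "even (size (filter_mset (\<lambda>f. f \<in> ?A - {e}) {#x, y#}))"
      "even (size (filter_mset (\<lambda>f. f \<in> ?B - {e}) {#x, y#}))"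
      using even_at_incidences[OF finD, of "?A - {e}" w] even_at_incidences[OF finD, of "?B - {e}" w]
      unfolding xy by blast+
    have xyE: "x \<in> edges G - {e}" "y \<in> edges G - {e}" using mem by auto
    \<comment> \<open>By parity, each of the two sets contains both or neither of \<open>x\<close>
      and \<open>y\<close>, and these memberships determine a colour below three.\<close>
    have "c x = c y"
      using ev xyE c3[of x] c3[of y] by (auto split: if_splits)
    then show ?thesis using mem[of a] mem[of b] w aE bE by auto
  qed
  have const: "c a = c b" if "(a, b) \<in> ?r" for a b
    using that by (induction rule: rtrancl_induct) (auto dest: step)
  define d where "d K = c (SOME a. a \<in> K)" for K
  have K: "K \<subseteq> edges G - {e} \<and> (\<forall>a\<in>K. d K = c a) \<and> (\<forall>a\<in>K. K = ?r `` {a})"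
    if KE: "K \<in> edges (suppress ?D S)" for K
  proof -
    obtain x where x: "x \<in> edges G - {e}" "K = ?r `` {x}"
      using KE by (auto simp: suppress_simps elim!: quotientE)
    have "K \<subseteq> edges G - {e}" using merge_class_subset[of x ?D S] x by simp
    moreover have "d K = c x"
    proof -
      have "x \<in> K" using x by auto
      then have "(SOME a. a \<in> K) \<in> K" by (rule someI)
      then show ?thesis using const x(2) by (auto simp: d_def)
    qed
    moreover have "c a = c x \<and> K = ?r `` {a}" if "a \<in> K" for a
    proof -
      have xa: "(x, a) \<in> ?r" using that x(2) by auto
      then have ax: "(a, x) \<in> ?r" using merge_rel_sym by (metis symD)
      have "?r `` {x} = ?r `` {a}" using xa ax by (auto intro: rtrancl_trans)
      then show ?thesis using const[OF ax] x(2) by simp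
    qed
    ultimately show ?thesis by auto
  qed
  have endsR: "w \<in># ends ?R f \<longleftrightarrow> w \<notin> S \<and> w \<in># ends G f" for w f
    by (auto simp: remove_verts_def)
  have distinct_at: "c f \<noteq> c g" if "f \<in> edges G" "g \<in> edges G" "f \<noteq> g" "w \<notin> S" "w \<in># ends G f" "w \<in># ends G g" for f g w
    using c that endsR[of w f] endsR[of w g] by (auto simp: proper_edge_colouring_def)
  have "proper_edge_colouring (suppress ?D S) 3 d"
    unfolding proper_edge_colouring_def
  proof (intro conjI ballI impI)
    fix L assume L: "L \<in> edges (suppress ?D S)"
    then obtain x where x: "x \<in> L" by (auto simp: suppress_simps elim!: quotientE)
    show "d L < 3" using K[OF L] x c3[of x] by auto
    show "\<not> is_loop (suppress ?D S) L"
    proof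
      assume "is_loop (suppress ?D S) L"
      then obtain w where w: "ends (suppress ?D S) L = {#w, w#}" by (auto simp: is_loop_def)
      then have wS: "w \<notin> S" using in_ends_suppress[OF finD, of L w S] K[OF L] by auto
      obtain a where a: "a \<in> L" "w \<in># ends G a"
        using in_ends_suppress[OF finD, of L w S] K[OF L] w by auto
      \<comment> \<open>Edges meeting at \<open>w\<close> have different colours whereas a class has
        a single colour, so \<open>a\<close> is the only member at \<open>w\<close>. A loop in the
        suppressed graph then comes from a loop \<open>a\<close>.\<close>
      have only: "count (ends G b) w = 0" if "b \<in> L" "b \<noteq> a" for b
        using distinct_at[of a b w] K[OF L] a that wS by (metis DiffD1 not_in_iff subsetD)
      have finL: "finite L" using K[OF L] finD finite_subset by fastforce
      have "count (ends (suppress ?D S) L) w = (\<Sum>b\<in>L. count (ends G b) w)"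
        using wS by (simp add: suppress_simps count_sum)
      also have "\<dots> = count (ends G a) w"
        using only sum.remove[OF finL a(1), of "\<lambda>b. count (ends G b) w"] by simp
      finally have "count (ends ?R a) w = 2" using w wS by (simp add: remove_verts_def)
      moreover have aG: "a \<in> edges G" using a K[OF L] by auto
      moreover have "size (ends ?R a) \<le> 2"
        using cubic_graphD(3)[OF G aG] size_filter_mset_lesseq[of _ "ends G a"] by (simp add: remove_verts_def)
      ultimately have "is_loop ?R a" using size_le_two_loop[of "ends ?R a" w] by (auto simp: is_loop_def)
      then show False using c aG by (auto simp: proper_edge_colouring_def)
    qed
  next
    fix L M assume L: "L \<in> edges (suppress ?D S)" and M: "M \<in> edges (suppress ?D S)"
      and "L \<noteq> M \<and> set_mset (ends (suppress ?D S) L) \<inter> set_mset (ends (suppress ?D S) M) \<noteq> {}"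
    then obtain w where w: "L \<noteq> M" "w \<in># ends (suppress ?D S) L" "w \<in># ends (suppress ?D S) M" by auto
    obtain a where a: "a \<in> L" "w \<in># ends G a" "w \<notin> S"
      using in_ends_suppress[OF finD, of L w S] K[OF L] w by auto
    obtain b where b: "b \<in> M" "w \<in># ends G b"
      using in_ends_suppress[OF finD, of M w S] K[OF M] w by auto
    have "a \<noteq> b" using K[OF L] K[OF M] a b w(1) by metis
    then have "c a \<noteq> c b" using distinct_at[of a b w] K[OF L] K[OF M] a b by auto
    then show "d L \<noteq> d M" using K[OF L] K[OF M] a b by auto
  qed
  then show ?thesis
    unfolding delete_suppress_eq(1)[OF G e] edge_colourable_def S_def by blast
qed

section \<open>Lifting colourings from the suppressed graph\<close>

lemma card_edges_at_le:
  assumes "finite (edges G)"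
  shows "card {a \<in> edges G. w \<in># ends G a} \<le> degree G w"
proof -
  have "card {a \<in> edges G. w \<in># ends G a} = (\<Sum>a | a \<in> edges G \<and> w \<in># ends G a. 1)" by simp
  also have "\<dots> \<le> (\<Sum>a | a \<in> edges G \<and> w \<in># ends G a. count (ends G a) w)"
    by (intro sum_mono) (simp add: Suc_le_eq)
  also have "\<dots> \<le> degree G w"
    unfolding degree_def using assms by (intro sum_mono2) auto
  finally show ?thesis .
qed

text \<open>A class avoiding \<open>u\<close> and \<open>v\<close> is a single edge. If no edge
  joins \<open>u\<close> and \<open>v\<close>, a class at one of them has at most two edges, each
  with at most one surviving end. If \<open>m\<close> joins them, \<open>m\<close> has no surviving
  end and each of \<open>u\<close>, \<open>v\<close> has at most one further edge.\<close>

lemma size_ends_suppress_le: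
  assumes fin: "finite (edges G)" and sz: "\<And>a. a \<in> edges G \<Longrightarrow> size (ends G a) = 2" and uv: "u \<noteq> v"
    and deg: "degree G u = 2" "degree G v = 2"
    and K: "K \<in> edges (suppress G {u, v})"
  shows "size (ends (suppress G {u, v}) K) \<le> 2"
proof -
  define outer where "outer a = size (filter_mset (\<lambda>x. x \<notin> {u, v}) (ends G a))" for a
  define U where "U w = {a \<in> edges G. w \<in># ends G a}" for w
  have U: "finite (U w)" for w using fin by (simp add: U_def)
  have cU: "card (U u) \<le> 2" "card (U v) \<le> 2"
    using card_edges_at_le[OF fin, of u] card_edges_at_le[OF fin, of v] deg by (simp_all add: U_def)
  obtain x where x: "x \<in> edges G" "K = (merge_rel G {u, v})\<^sup>* `` {x}"
    using K unfolding suppress_simps by (rule quotientE)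
  have KE: "K \<subseteq> edges G" unfolding x(2) by (rule merge_class_subset[OF x(1)])
  then have finK: "finite K" using fin finite_subset by blast
  have size_K: "size (ends (suppress G {u, v}) K) = (\<Sum>a\<in>K. outer a)"
    using finK unfolding suppress_simps outer_def by (induction K) auto
  have closed: "K \<subseteq> X" if "x \<in> X" "\<And>a b. a \<in> X \<Longrightarrow> (a, b) \<in> merge_rel G {u, v} \<Longrightarrow> b \<in> X" for X
    using merge_class_closed[of x _ G "{u, v}" X] that x(2) by blast
  have outer1: "outer a \<le> 1" if "a \<in> U u \<union> U v" for a
  proof -
    have "filter_mset (\<lambda>x. x \<notin> {u, v}) (ends G a) \<subset># ends G a"
      using that by (auto simp: U_def intro!: subset_mset.le_neq_trans dest: filter_mset_eq_conv[THEN iffD1])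
    then have "outer a < size (ends G a)" unfolding outer_def by (rule mset_subset_size)
    then show ?thesis using sz that by (auto simp: U_def)
  qed
  \<comment> \<open>The parameter \<open>m\<close> admits one extra edge without surviving ends;
    where there is none, a member of \<open>L\<close> takes its place.\<close>
  have card_bound: "(\<Sum>a\<in>K. outer a) \<le> 2" if "K \<subseteq> insert m L" "L \<subseteq> U u \<union> U v" "finite L" "card L \<le> 2" "m \<in> L \<or> outer m = 0" for L m
  proof -
    have "(\<Sum>a\<in>K. outer a) \<le> (\<Sum>a\<in>insert m L. outer a)"
      using that by (intro sum_mono2) auto
    also have "\<dots> = (\<Sum>a\<in>L. outer a)"
      using that by (cases "m \<in> L") (auto simp: insert_absorb)
    also have "\<dots> \<le> (\<Sum>a\<in>L. 1)" using that outer1 by (intro sum_mono) auto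
    finally show ?thesis using that(4) by simp
  qed
  have "(\<Sum>a\<in>K. outer a) \<le> 2"
  proof (cases "x \<in> U u \<union> U v")
    case False
    have "K \<subseteq> {x}"
      by (rule closed) (use False in \<open>auto simp: merge_rel_def U_def\<close>)
    then have "(\<Sum>a\<in>K. outer a) \<le> (\<Sum>a\<in>{x}. outer a)" by (intro sum_mono2) auto
    also have "\<dots> \<le> 2" using size_filter_mset_lesseq[of _ "ends G x"] sz[OF x(1)] by (simp add: outer_def)
    finally show ?thesis .
  next
    case True
    show ?thesis
    proof (cases "U u \<inter> U v = {}")
      case disj: True
      have "K \<subseteq> U w" if "x \<in> U w" "w \<in> {u, v}" for w
      proof (rule closed[OF that(1)])
        fix a b assume "a \<in> U w" "(a, b) \<in> merge_rel G {u, v}"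
        then obtain w' where "w' \<in> {u, v}" "a \<in> U w'" "b \<in> U w'" by (auto simp: merge_rel_def U_def)
        moreover from this have "w' = w" using disj \<open>a \<in> U w\<close> that(2) by auto
        ultimately show "b \<in> U w" by simp
      qed
      then have "K \<subseteq> U u \<or> K \<subseteq> U v" using True by auto
      then show ?thesis
        using card_bound[of x "U u"] card_bound[of x "U v"] cU U True x(2) by blast
    next
      case False
      then obtain m where m: "m \<in> U u" "m \<in> U v" by auto
      have "ends G m = {#u, v#}"
      proof -
        obtain y where "ends G m = {#u, y#}"
          using size_two_multiset[of "ends G m" u] sz[of m] m by (auto simp: U_def)
        then show ?thesis using m(2) uv by (auto simp: U_def)
      qed
      then have "outer m = 0" by (simp add: outer_def)
      moreover have "K \<subseteq> U u \<union> U v"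
        by (rule closed[OF True]) (auto simp: merge_rel_def U_def)
      moreover have "card ((U u - {m}) \<union> (U v - {m})) \<le> 2"
        using card_Un_le[of "U u - {m}" "U v - {m}"] m cU U by (simp add: card_Diff_singleton)
      ultimately show ?thesis
        using card_bound[of m "(U u - {m}) \<union> (U v - {m})"] U by blast
    qed
  qed
  then show ?thesis by (simp add: size_K)
qed

text \<open>Each edge inherits the colour of its class. Two edges of one class cannot meet outside
  \<open>S\<close>: that vertex would be both ends of the class, making it a loop in a properly
  coloured graph.\<close>

lemma colourable_of_delete_suppress:
  assumes G: "cubic_graph G" and e: "e \<in> edges G" "ends G e = {#u, v#}" "u \<noteq> v"
    and col: "edge_colourable (delete_suppress G e) 3"
  shows "edge_colourable (remove_verts G {u, v}) 3"
proof -
  define S where "S = {u, v}"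
  let ?D = "delete_edges G {e}" and ?R = "remove_verts G S"
  let ?r = "(merge_rel ?D S)\<^sup>*"
  have finD: "finite (edges ?D)" using cubic_graphD(2)[OF G] by simp
  obtain c where c: "proper_edge_colouring (suppress ?D S) 3 c"
    using col unfolding delete_suppress_eq(1)[OF G e] by (auto simp: edge_colourable_def S_def)
  define k where "k a = ?r `` {a}" for a
  have kE: "k a \<in> edges (suppress ?D S)" if "a \<in> edges G - {e}" for a
    using that by (auto simp: k_def suppress_simps intro: quotientI)
  have ksub: "k a \<subseteq> edges ?D" if "a \<in> edges G - {e}" for a
    using merge_class_subset[of a ?D S] that by (simp add: k_def)
  have ak: "a \<in> k a" for a by (simp add: k_def)
  have few: "count (ends (suppress ?D S) (k a)) w < 2" if a: "a \<in> edges G - {e}" for a w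
  proof (rule ccontr)
    assume "\<not> ?thesis"
    then have "2 \<le> count (ends (suppress ?D S) (k a)) w" by simp
    moreover have "size (ends (suppress ?D S) (k a)) \<le> 2"
      unfolding S_def
    proof (rule size_ends_suppress_le[OF finD _ e(3)])
      show "degree ?D u = 2" "degree ?D v = 2" using delete_suppress_eq(2)[OF G e] by auto
      show "k a \<in> edges (suppress ?D {u, v})" using kE[OF a] by (simp add: S_def)
    qed (use cubic_graphD(3)[OF G] in auto)
    ultimately have "is_loop (suppress ?D S) (k a)" unfolding is_loop_def by (blast intro: size_le_two_loop)
    then show False using c kE[OF a] by (auto simp: proper_edge_colouring_def)
  qed
  have count_k: "count (ends (suppress ?D S) (k a)) w = (\<Sum>b\<in>k a. count (ends G b) w)" if "w \<notin> S" for a w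
    using that by (simp add: suppress_simps count_sum)
  have fink: "finite (k a)" if "a \<in> edges G - {e}" for a
    using ksub[OF that] finD finite_subset by blast
  have not_e: "a \<noteq> e" if "w \<in># ends ?R a" for a w
    using that e(2) by (auto simp: remove_verts_def S_def)
  have endsR: "w \<in># ends ?R f \<longleftrightarrow> w \<notin> S \<and> w \<in># ends G f" for w f
    by (auto simp: remove_verts_def)
  \<comment> \<open>The edge \<open>e\<close> belongs to no class, so \<open>c\<close> says nothing
    about it; in \<open>?R\<close> it has lost both ends, and the default colour 0 causes no
    conflict.\<close>
  define d where "d a = (if a = e then 0 else c (k a))" for a
  have "proper_edge_colouring ?R 3 d"
    unfolding proper_edge_colouring_def edges_remove_verts
  proof (intro conjI ballI impI)
    fix a assume a: "a \<in> edges G"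
    show "d a < 3" using c kE[of a] a by (auto simp: d_def proper_edge_colouring_def)
    show "\<not> is_loop ?R a"
    proof
      assume "is_loop ?R a"
      then obtain w where w: "ends ?R a = {#w, w#}" by (auto simp: is_loop_def)
      then have wS: "w \<notin> S" and ae: "a \<in> edges G - {e}" using endsR[of w a] not_e[of w a] a by auto
      have "count (ends G a) w = 2" using w wS count_remove_verts[of w S G a] by simp
      moreover have "count (ends G a) w \<le> (\<Sum>b\<in>k a. count (ends G b) w)"
        using ak fink[OF ae] by (intro member_le_sum) auto
      ultimately show False using few[OF ae, of w] count_k[OF wS, of a] by simp
    qed
  next
    fix a b assume ab: "a \<in> edges G" "b \<in> edges G"
      and "a \<noteq> b \<and> set_mset (ends ?R a) \<inter> set_mset (ends ?R b) \<noteq> {}"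
    then obtain w where ne: "a \<noteq> b" and w: "w \<in># ends ?R a" "w \<in># ends ?R b" by auto
    have aE: "a \<in> edges G - {e}" "b \<in> edges G - {e}" using ab w not_e by auto
    have wS: "w \<notin> S" "w \<in># ends G a" "w \<in># ends G b" using w endsR by auto
    have "k a \<noteq> k b"
    proof
      assume "k a = k b"
      then have "{a, b} \<subseteq> k a" using ak by blast
      then have "(\<Sum>x\<in>{a, b}. count (ends G x) w) \<le> (\<Sum>x\<in>k a. count (ends G x) w)"
        using fink[OF aE(1)] by (intro sum_mono2) auto
      moreover have "(\<Sum>x\<in>{a, b}. count (ends G x) w) \<ge> 2"
        using ne wS(2,3) by (simp flip: count_greater_zero_iff)
      ultimately show False using few[OF aE(1), of w] count_k[OF wS(1), of a] by simp
    qed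
    moreover have "w \<in># ends (suppress ?D S) (k a)" "w \<in># ends (suppress ?D S) (k b)"
      using in_ends_suppress[OF finD ksub[OF aE(1)], of w S] in_ends_suppress[OF finD ksub[OF aE(2)], of w S]
        wS ak by auto
    ultimately have "c (k a) \<noteq> c (k b)"
      using c kE[OF aE(1)] kE[OF aE(2)] unfolding proper_edge_colouring_def by blast
    then show "d a \<noteq> d b" using aE by (simp add: d_def)
  qed
  then show ?thesis by (auto simp: edge_colourable_def S_def)
qed

lemma critical_iff_delete_suppress:
  assumes G: "cubic_graph G" and "\<not> edge_colourable G 3"
  shows "critical G \<longleftrightarrow> (\<forall>e\<in>edges G. \<not> is_loop G e \<longrightarrow> edge_colourable (delete_suppress G e) 3)"
proof (intro iffI ballI impI)
  fix e assume crit: "critical G" and e: "e \<in> edges G" "\<not> is_loop G e"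
  obtain u v where uv: "ends G e = {#u, v#}" using size_two_cases cubic_graphD(3)[OF G e(1)] by blast
  then have "u \<noteq> v" using e(2) by (auto simp: is_loop_def)
  moreover have "u \<in> verts G" "v \<in> verts G" using cubic_graphD(4)[OF G e(1)] uv by auto
  ultimately have "edge_colourable (remove_verts G {u, v}) 3"
    using crit e(1) uv by (auto simp: critical_def adjacent_def)
  then show "edge_colourable (delete_suppress G e) 3"
    using colourable_delete_suppress[OF assms(2) G e(1) uv \<open>u \<noteq> v\<close>] by simp
next
  assume *: "\<forall>e\<in>edges G. \<not> is_loop G e \<longrightarrow> edge_colourable (delete_suppress G e) 3"
  show "critical G" unfolding critical_def
  proof (intro ballI impI)
    fix u v assume "adjacent G u v"
    then obtain e where e: "e \<in> edges G" "ends G e = {#u, v#}" "u \<noteq> v" by (auto simp: adjacent_def)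
    then have "\<not> is_loop G e" by (auto simp: is_loop_def pair_mset_eq_iff)
    then show "edge_colourable (remove_verts G {u, v}) 3"
      using * colourable_of_delete_suppress[OF G e] e(1) by blast
  qed
qed

subsection \<open>Irreducibility\<close>

lemma edge_colourable_mono:
  assumes "edge_colourable G k" "k \<le> l" shows "edge_colourable G l"
proof -
  obtain c where "proper_edge_colouring G k c" using assms(1) by (auto simp: edge_colourable_def)
  then have "proper_edge_colouring G l c"
    using assms(2) unfolding proper_edge_colouring_def by (meson less_le_trans)
  then show ?thesis by (auto simp: edge_colourable_def)
qed

lemma four_le_chromatic_index_iff: "4 \<le> chromatic_index G \<longleftrightarrow> \<not> edge_colourable G 3"
proof -
  have "4 \<le> chromatic_index G \<longleftrightarrow> (\<forall>k. edge_colourable G k \<longrightarrow> 4 \<le> k)"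
    by (simp add: chromatic_index_def le_INF_iff numeral_eq_enat)
  also have "\<dots> \<longleftrightarrow> \<not> edge_colourable G 3"
  proof
    assume "\<forall>k. edge_colourable G k \<longrightarrow> 4 \<le> k"
    from this[rule_format, of 3] show "\<not> edge_colourable G 3" by auto
  next
    assume neg: "\<not> edge_colourable G 3"
    show "\<forall>k. edge_colourable G k \<longrightarrow> 4 \<le> k"
    proof (intro allI impI)
      fix k assume "edge_colourable G k"
      then have "\<not> k \<le> 3" using neg edge_colourable_mono by blast
      then show "4 \<le> k" by simp
    qed
  qed
  finally show ?thesis .
qed

text \<open>A dangling edge meets at most two other edges, all at its only end, so one of the three
  colours remains free.\<close>

lemma colourable_extend_dangling_edge:
  assumes fin: "finite (edges G)" and f: "f \<in> edges G" "size (ends G f) \<le> 1"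
    and deg: "\<And>v. degree G v \<le> 3" and col: "edge_colourable (delete_edges G {f}) 3"
  shows "edge_colourable G 3"
proof -
  obtain c where c: "proper_edge_colouring (delete_edges G {f}) 3 c"
    using col by (auto simp: edge_colourable_def)
  define N where "N = {g \<in> edges G - {f}. set_mset (ends G g) \<inter> set_mset (ends G f) \<noteq> {}}"
  have finN: "finite N" using fin by (simp add: N_def)
  have "card N < 3"
  proof (cases "ends G f = {#}")
    case True
    then show ?thesis by (simp add: N_def)
  next
    case False
    then have "size (ends G f) = 1" using f(2) by (cases "size (ends G f)") auto
    then obtain w where w: "ends G f = {#w#}" using size_1_singleton_mset by blast
    let ?W = "{a \<in> edges G. w \<in># ends G a}"
    have "f \<in> ?W" "N = ?W - {f}" using f w by (auto simp: N_def)
    moreover have "finite ?W" using fin by simp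
    ultimately have "card N < card ?W" by (metis card_Diff1_less)
    then show ?thesis using card_edges_at_le[OF fin, of w] deg[of w] by simp
  qed
  then have "card (c ` N) < card {..<3::nat}" using card_image_le[OF finN, of c] by simp
  then obtain i where i: "i < 3" "i \<notin> c ` N"
    using finN by (metis card_mono finite_imageI lessThan_iff linorder_not_le subsetI)
  have "proper_edge_colouring G 3 (c(f := i))"
    unfolding proper_edge_colouring_def
  proof (intro conjI ballI impI)
    fix a assume a: "a \<in> edges G"
    show "(c(f := i)) a < 3" using c i a by (auto simp: proper_edge_colouring_def)
    show "\<not> is_loop G a"
      using c a f by (cases "a = f") (auto simp: proper_edge_colouring_def is_loop_def)
  next
    fix a b assume ab: "a \<in> edges G" "b \<in> edges G"
      "a \<noteq> b \<and> set_mset (ends G a) \<inter> set_mset (ends G b) \<noteq> {}"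
    consider "a = f" "b \<in> N" | "b = f" "a \<in> N" | "a \<noteq> f" "b \<noteq> f"
      using ab by (auto simp: N_def)
    then show "(c(f := i)) a \<noteq> (c(f := i)) b"
    proof cases
      case 3
      then show ?thesis using c ab by (simp add: proper_edge_colouring_def)
    qed (use i ab in auto)
  qed
  then show ?thesis by (auto simp: edge_colourable_def)
qed

lemma colourable_extend_dangling_edges:
  assumes fin: "finite (edges G)" and deg: "\<And>v. degree G v \<le> 3" and X: "finite X"
    and "X \<subseteq> edges G" "\<And>f. f \<in> X \<Longrightarrow> size (ends G f) \<le> 1" "edge_colourable (delete_edges G X) 3"
  shows "edge_colourable G 3"
  using X assms(4-)
proof (induction X)
  case empty
  have "delete_edges G {} = G" by (simp add: delete_edges_def)
  then show ?case using empty.prems(3) by (simp only:)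
next
  case (insert f X)
  have "degree (delete_edges G X) v \<le> 3" for v
  proof -
    have "degree (delete_edges G X) v \<le> degree G v"
      unfolding degree_def using fin by (auto intro: sum_mono2)
    then show ?thesis using deg[of v] by simp
  qed
  moreover have "delete_edges (delete_edges G X) {f} = delete_edges G (insert f X)"
    by (auto simp: delete_edges_def)
  ultimately have "edge_colourable (delete_edges G X) 3"
    using insert fin by (intro colourable_extend_dangling_edge[of "delete_edges G X" f]) auto
  then show ?case using insert by simp
qed

section \<open>Components and the completion of a cut graph\<close>

lemma component_of_adjacent:
  assumes "adjacent G x y" shows "component_of G x = component_of G y"
proof -
  have "adjacent G y x" using assms by (auto simp: adjacent_def add_mset_commute)
  then have "reachable G x w \<longleftrightarrow> reachable G y w" for w
    using assms unfolding reachable_def by (meson converse_rtranclp_into_rtranclp)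
  then show ?thesis by (simp add: component_of_def)
qed

lemma component_of_simps:
  "verts (component_of G x) = {w \<in> verts G. reachable G x w}"
  "edges (component_of G x) = {e \<in> edges G. set_mset (ends G e) \<inter> {w \<in> verts G. reachable G x w} \<noteq> {}}"
  "ends (component_of G x) = ends G"
  by (simp_all add: component_of_def Let_def)

text \<open>An edge takes its colour from the component of any of its ends in \<open>W\<close>. Two
  such ends are equal or adjacent, so the choice does not matter, and edges meeting in
  \<open>W\<close> are coloured by the same component.\<close>

lemma glue_component_colourings:
  assumes G: "fin_graph G" and W: "W \<subseteq> verts G"
    and col: "\<And>x. x \<in> W \<Longrightarrow> edge_colourable (component_of G x) k"
  obtains c where "\<And>e w. e \<in> edges G \<Longrightarrow> w \<in> W \<Longrightarrow> w \<in># ends G e \<Longrightarrow> c e < k \<and> \<not> is_loop G e"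
    "\<And>e f w. e \<in> edges G \<Longrightarrow> f \<in> edges G \<Longrightarrow> e \<noteq> f \<Longrightarrow> w \<in> W \<Longrightarrow> w \<in># ends G e \<Longrightarrow> w \<in># ends G f \<Longrightarrow> c e \<noteq> c f"
proof -
  define g where "g C = (SOME c. proper_edge_colouring C k c)" for C :: "('a, 'b) multigraph"
  have g: "proper_edge_colouring (component_of G x) k (g (component_of G x))" if "x \<in> W" for x
    using someI_ex col[OF that] unfolding g_def edge_colourable_def by metis
  define c where "c e = g (component_of G (SOME x. x \<in> W \<and> x \<in># ends G e)) e" for e
  have c: "c e = g (component_of G w) e" if e: "e \<in> edges G" "w \<in> W" "w \<in># ends G e" for e w
  proof -
    define x where "x = (SOME x. x \<in> W \<and> x \<in># ends G e)"
    have x: "x \<in> W \<and> x \<in># ends G e" unfolding x_def by (rule someI[of _ w]) (use e in auto)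
    have "component_of G x = component_of G w"
    proof (cases "x = w")
      case False
      have "size (ends G e) = 2" using G e(1) by (simp add: fin_graph_def)
      then obtain y where y: "ends G e = {#x, y#}" using size_two_multiset x by metis
      then have "y = w" using e(3) False by auto
      then show ?thesis using component_of_adjacent False y e(1) by (metis adjacent_def)
    qed simp
    then show ?thesis by (simp add: c_def x_def)
  qed
  have inC: "e \<in> edges (component_of G w)" if "e \<in> edges G" "w \<in> W" "w \<in># ends G e" for e w
    using that W by (auto simp: component_of_simps reachable_def)
  show thesis
  proof (rule that[of c])
    fix e w assume e: "e \<in> edges G" "w \<in> W" "w \<in># ends G e"
    show "c e < k \<and> \<not> is_loop G e"
      using g[OF e(2)] inC[OF e] c[OF e] by (auto simp: proper_edge_colouring_def is_loop_def component_of_simps(3))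
  next
    fix e f w assume e: "e \<in> edges G" "f \<in> edges G" "e \<noteq> f" "w \<in> W" "w \<in># ends G e" "w \<in># ends G f"
    have "g (component_of G w) e \<noteq> g (component_of G w) f"
      using g[OF e(4)] inC[OF e(1,4,5)] inC[OF e(2,4,6)] e
      unfolding proper_edge_colouring_def component_of_simps(3) by blast
    then show "c e \<noteq> c f" using c[OF e(1,4,5)] c[OF e(2,4,6)] by simp
  qed
qed

text \<open>Cut ends are joined in pairs, each new edge reusing the name of one edge of its pair.
  Equality of the sums of ends means that every vertex regains the degree lost by the cut; equal
  points yield a loop.\<close>

lemma pair_up_points:
  fixes p :: "'e \<Rightarrow> 'v"
  assumes "finite F" "even (card F)"
  shows "\<exists>F' en. F' \<subseteq> F \<and> (\<forall>f\<in>F'. size (en f) = 2) \<and> (\<Sum>f\<in>F'. en f) = (\<Sum>f\<in>F. {#p f#})"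
  using assms
proof (induction "card F" arbitrary: F rule: less_induct)
  case less
  show ?case
  proof (cases "F = {}")
    case False
    then obtain f where f: "f \<in> F" by blast
    have "F \<noteq> {f}" using less.prems by auto
    then obtain g where g: "g \<in> F" "g \<noteq> f" using f by blast
    define R where "R = F - {f, g}"
    have R: "F = insert f (insert g R)" "f \<notin> R" "g \<notin> R" "finite R"
      using f g less.prems by (auto simp: R_def)
    then have "card F = card R + 2" using g(2) by simp
    then obtain F' en where IH: "F' \<subseteq> R" "\<forall>f\<in>F'. size (en f) = 2" "(\<Sum>f\<in>F'. en f) = (\<Sum>f\<in>R. {#p f#})"
      using less.hyps[of R] less.prems(2) R(4) by auto
    let ?en = "en(f := {#p f, p g#})"
    have fF': "f \<notin> F'" "finite F'" using IH(1) R finite_subset by auto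
    have "(\<Sum>x\<in>F'. ?en x) = (\<Sum>x\<in>F'. en x)" using fF' by (intro sum.cong) auto
    then have "(\<Sum>x\<in>insert f F'. ?en x) = {#p f, p g#} + (\<Sum>x\<in>R. {#p x#})"
      using fF' IH(3) by simp
    also have "\<dots> = (\<Sum>x\<in>F. {#p x#})" unfolding R(1) using R(2-4) g(2) by simp
    finally show ?thesis
      using IH(1,2) R(1) by (intro exI[of _ "insert f F'"] exI[of _ ?en]) auto
  qed auto
qed

text \<open>An uncolourable \<open>G - {u, v}\<close> yields a forbidden cut: \<open>F\<close>
  separates \<open>u\<close>, \<open>v\<close> from the rest, has at most four edges, and is even,
  so its outer ends can be joined in pairs to complete the rest to the smaller cubic graph
  \<open>H\<close>.\<close>

lemma irreducible_imp_critical: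
  fixes G :: "('v, 'e) multigraph"
  assumes G: "cubic_graph G" and irr: "irreducible_graph 5 G"
  shows "critical G"
proof (rule ccontr)
  assume "\<not> critical G"
  then obtain u v where uv: "u \<in> verts G" "v \<in> verts G" "adjacent G u v"
    and unc: "\<not> edge_colourable (remove_verts G {u, v}) 3" by (auto simp: critical_def)
  obtain e where e: "e \<in> edges G" "ends G e = {#u, v#}" "u \<noteq> v" using uv by (auto simp: adjacent_def)
  define S where "S = {u, v}"
  define I where "I = {f \<in> edges G. set_mset (ends G f) \<subseteq> S}"
  define Out where "Out = {f \<in> edges G. set_mset (ends G f) \<inter> S = {}}"
  define F where "F = edges G - I - Out"
  note finE = cubic_graphD(2)[OF G]
  have fin: "finite I" "finite Out" "finite F" using finE by (auto simp: I_def Out_def F_def)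
  have dis: "I \<inter> Out = {}" "F \<inter> Out = {}" "F \<inter> I = {}"
  proof -
    have "ends G f \<noteq> {#}" if "f \<in> edges G" for f using cubic_graphD(3)[OF G that] by auto
    then show "I \<inter> Out = {}" by (fastforce simp: I_def Out_def)
  qed (auto simp: F_def)
  have E: "edges G = I \<union> (F \<union> Out)" by (auto simp: F_def I_def Out_def)
  have sides: "f \<in> I \<or> f \<in> Out" if "f \<in> edges G - F" for f using that by (auto simp: F_def)
  have shape: "\<exists>s p. s \<in> S \<and> p \<in> verts G - S \<and> ends G f = {#s, p#}" if f: "f \<in> F" for f
  proof -
    obtain s where s: "s \<in># ends G f" "s \<in> S" and fE: "f \<in> edges G"
      using f by (auto simp: F_def Out_def)
    obtain p where p: "ends G f = {#s, p#}" using size_two_multiset cubic_graphD(3)[OF G fE] s(1) by metis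
    then have "p \<notin> S" using f s by (auto simp: F_def I_def)
    then show ?thesis using p s cubic_graphD(4)[OF G fE, of p] by auto
  qed
  then obtain s p where sp: "\<And>f. f \<in> F \<Longrightarrow> s f \<in> S \<and> p f \<in> verts G - S \<and> ends G f = {#s f, p f#}"
    by metis
  have cntF: "count (ends G f) u + count (ends G f) v = 1" if "f \<in> F" for f
    using sp[OF that] e(3) by (auto simp: S_def)
  have cntO: "count (ends G f) u + count (ends G f) v = 0" if "f \<in> Out" for f
    using that by (auto simp: Out_def S_def count_eq_zero_iff)
  have cntI: "count (ends G f) u + count (ends G f) v = 2" if f: "f \<in> I" for f
  proof -
    have fE: "f \<in> edges G" and sub: "set_mset (ends G f) \<subseteq> S" using f by (auto simp: I_def)
    obtain x y where "ends G f = {#x, y#}" using size_two_cases cubic_graphD(3)[OF G fE] by blast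
    then show ?thesis using sub e(3) by (auto simp: S_def)
  qed
  \<comment> \<open>Counting incidences at \<open>u\<close> and \<open>v\<close>: edges of
    \<open>I\<close> count twice and those of \<open>F\<close> once. This gives the parity of
    \<open>card F\<close> and, as \<open>e\<close> lies in \<open>I\<close>, the bound four.\<close>
  have "6 = degree G u + degree G v" using cubic_graphD(5)[OF G] uv by simp
  also have "\<dots> = (\<Sum>f\<in>edges G. count (ends G f) u + count (ends G f) v)"
    by (simp add: degree_def sum.distrib)
  also have "\<dots> = (\<Sum>f\<in>I. 2) + ((\<Sum>f\<in>F. 1) + (\<Sum>f\<in>Out. 0))"
    unfolding E using fin dis cntF cntO cntI
    by (subst sum.union_disjoint; (subst sum.union_disjoint)?) auto
  finally have card_eq: "6 = 2 * card I + card F" by simp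
  have "e \<in> I" using e by (auto simp: I_def S_def)
  then have "card I \<ge> 1" using fin(1) by (metis One_nat_def Suc_leI card_gt_0_iff empty_iff)
  then have cardF: "card F < 5" using card_eq by simp
  have "even (card F)" using card_eq by presburger
  then obtain F' en where F': "F' \<subseteq> F" "\<And>f. f \<in> F' \<Longrightarrow> size (en f) = 2"
    "(\<Sum>f\<in>F'. en f) = (\<Sum>f\<in>F. {#p f#})"
    using pair_up_points[OF fin(3), of p] by metis
  have finF': "finite F'" using F'(1) fin finite_subset by blast
  \<comment> \<open>The at most four edges leaving \<open>{u, v}\<close> are joined in pairs, and their names are reused.\<close>
  define H where "H = \<lparr>verts = verts G - S, edges = Out \<union> F', ends = \<lambda>f. if f \<in> Out then ends G f else en f\<rparr>"
  have disF': "Out \<inter> F' = {}" using F'(1) dis by auto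
  have en_sub: "set_mset (en f) \<subseteq> verts G - S" if "f \<in> F'" for f
  proof
    fix x assume "x \<in># en f"
    then have "x \<in># (\<Sum>f\<in>F'. en f)" using that finF' by (auto simp: set_mset_sum)
    then have "x \<in> p ` F" unfolding F'(3) using fin(3) by (auto simp: set_mset_sum)
    then show "x \<in> verts G - S" using sp by auto
  qed
  have "fin_graph H"
    unfolding fin_graph_def
  proof (intro conjI ballI)
    show "finite (verts H)" "finite (edges H)" using cubic_graphD(1)[OF G] fin finF' by (auto simp: H_def)
    fix f assume f: "f \<in> edges H"
    show "size (ends H f) = 2"
      using f F'(2) cubic_graphD(3)[OF G, of f] by (auto simp: H_def Out_def)
    show "set_mset (ends H f) \<subseteq> verts H"
    proof (cases "f \<in> Out")
      case True
      then show ?thesis using cubic_graphD(4)[OF G, of f] by (auto simp: H_def Out_def)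
    next
      case False
      then show ?thesis using f en_sub[of f] by (auto simp: H_def)
    qed
  qed
  moreover have "degree H w = 3" if w: "w \<in> verts H" for w
  proof -
    have wS: "w \<in> verts G" "w \<notin> S" using w by (auto simp: H_def)
    have "degree H w = (\<Sum>f\<in>Out. count (ends H f) w) + (\<Sum>f\<in>F'. count (ends H f) w)"
      using fin finF' disF' by (simp add: degree_def H_def sum.union_disjoint)
    also have "(\<Sum>f\<in>Out. count (ends H f) w) = (\<Sum>f\<in>Out. count (ends G f) w)"
      by (intro sum.cong) (auto simp: H_def)
    also have "(\<Sum>f\<in>F'. count (ends H f) w) = (\<Sum>f\<in>F'. count (en f) w)"
      using disF' by (intro sum.cong) (auto simp: H_def)
    also have "\<dots> = count (\<Sum>f\<in>F. {#p f#}) w" unfolding F'(3)[symmetric] by (simp add: count_sum)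
    also have "\<dots> = (\<Sum>f\<in>F. count (ends G f) w)"
      unfolding count_sum
    proof (rule sum.cong)
      fix f assume "f \<in> F"
      then show "count {#p f#} w = count (ends G f) w" using sp[of f] wS by auto
    qed simp
    finally have "degree H w = (\<Sum>f\<in>Out. count (ends G f) w) + (\<Sum>f\<in>F. count (ends G f) w)" .
    moreover have "(\<Sum>f\<in>I. count (ends G f) w) = 0"
      using wS by (intro sum.neutral) (auto simp: I_def count_eq_zero_iff)
    moreover have "degree G w = (\<Sum>f\<in>I. count (ends G f) w) +
        ((\<Sum>f\<in>F. count (ends G f) w) + (\<Sum>f\<in>Out. count (ends G f) w))"
      unfolding degree_def E using fin dis by (subst sum.union_disjoint; (subst sum.union_disjoint)?) auto
    ultimately show ?thesis using cubic_graphD(5)[OF G wS(1)] by simp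
  qed
  ultimately have H: "cubic_graph H" by (auto simp: cubic_graph_def)
  let ?D = "delete_edges G F"
  \<comment> \<open>Otherwise the component colourings glue to a colouring of \<open>Out\<close>.
    All other edges have at most one end in \<open>G - {u, v}\<close> and can be coloured one by
    one, contradicting \<open>unc\<close>.\<close>
  have "\<exists>x\<in>verts G - S. \<not> edge_colourable (component_of ?D x) 3"
  proof (rule ccontr)
    assume neg: "\<not> ?thesis"
    have "fin_graph ?D" using G by (auto simp: cubic_graph_def fin_graph_def)
    then obtain c :: "'e \<Rightarrow> nat" where c: "\<And>f w. f \<in> edges ?D \<Longrightarrow> w \<in> verts G - S \<Longrightarrow> w \<in># ends ?D f \<Longrightarrow> c f < 3 \<and> \<not> is_loop ?D f"
      "\<And>f g w. f \<in> edges ?D \<Longrightarrow> g \<in> edges ?D \<Longrightarrow> f \<noteq> g \<Longrightarrow> w \<in> verts G - S \<Longrightarrow>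
        w \<in># ends ?D f \<Longrightarrow> w \<in># ends ?D g \<Longrightarrow> c f \<noteq> c g"
      using glue_component_colourings[of ?D "verts G - S" 3] neg by auto
    let ?R = "remove_verts G S"
    have RO: "edges (delete_edges ?R (F \<union> I)) = Out" using E dis by auto
    have endsO: "ends ?R f = ends G f" if "f \<in> Out" for f
      using that by (auto simp: Out_def remove_verts_def filter_mset_eq_conv)
    have OD: "f \<in> edges ?D" if "f \<in> Out" for f using that E dis by auto
    have OV: "w \<in> verts G - S" if "f \<in> Out" "w \<in># ends G f" for f w
      using that cubic_graphD(4)[OF G, of f w] by (auto simp: Out_def)
    have "proper_edge_colouring (delete_edges ?R (F \<union> I)) 3 c"
      unfolding proper_edge_colouring_def RO
    proof (intro conjI ballI impI)
      fix f assume f: "f \<in> Out"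
      have "ends G f \<noteq> {#}" using cubic_graphD(3)[OF G, of f] f by (auto simp: Out_def)
      then obtain w where w: "w \<in># ends G f" by (meson multiset_nonemptyE)
      have "c f < 3 \<and> \<not> is_loop ?D f" using c(1)[OF OD[OF f] OV[OF f w]] w by simp
      then show "c f < 3" "\<not> is_loop (delete_edges ?R (F \<union> I)) f"
        using endsO[OF f] by (auto simp: is_loop_def)
    next
      fix f g assume fg: "f \<in> Out" "g \<in> Out"
        "f \<noteq> g \<and> set_mset (ends (delete_edges ?R (F \<union> I)) f) \<inter> set_mset (ends (delete_edges ?R (F \<union> I)) g) \<noteq> {}"
      then obtain w where w: "w \<in># ends G f" "w \<in># ends G g" using endsO by auto
      show "c f \<noteq> c g" using c(2)[OF OD[OF fg(1)] OD[OF fg(2)] _ OV[OF fg(1) w(1)]] w fg(3) by simp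
    qed
    then have col: "edge_colourable (delete_edges ?R (F \<union> I)) 3" by (auto simp: edge_colourable_def)
    have "edge_colourable ?R 3"
    proof (rule colourable_extend_dangling_edges[OF _ _ _ _ _ col])
      show "degree ?R w \<le> 3" for w
      proof (cases "w \<in> verts G - S")
        case True
        then show ?thesis using degree_remove_verts[of w S G] cubic_graphD(5)[OF G, of w] by simp
      next
        case False
        have "w \<notin># ends ?R f" if "f \<in> edges G" for f
          using False cubic_graphD(4)[OF G that, of w] by (auto simp: remove_verts_def)
        then have "degree ?R w = 0" unfolding degree_def by (intro sum.neutral) (auto simp: count_eq_zero_iff)
        then show ?thesis by simp
      qed
      show "size (ends ?R f) \<le> 1" if "f \<in> F \<union> I" for f
      proof (cases "f \<in> F")
        case True
        then show ?thesis using sp[OF True] by (simp add: remove_verts_def)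
      next
        case False
        then have "ends ?R f = {#}" using that by (auto simp: remove_verts_def I_def filter_mset_eq_conv filter_mset_False)
        then show ?thesis by simp
      qed
    qed (use finE fin E in auto)
    then show False using unc by (simp add: S_def)
  qed
  then obtain x where x: "x \<in> verts G - S" "\<not> edge_colourable (component_of ?D x) 3" by blast
  \<comment> \<open>With \<open>F\<close> deleted, no edge joins \<open>S\<close> to its
    complement.\<close>
  have stay: "w \<in> verts G - S" if "reachable ?D x w" for w
    using that unfolding reachable_def
  proof (induction rule: rtranclp_induct)
    case (step y z)
    then obtain f where f: "f \<in> edges G - F" "ends G f = {#y, z#}" by (auto simp: adjacent_def)
    then have "f \<in> Out" using step.IH sides[of f] by (auto simp: I_def)
    then show ?case using f cubic_graphD(4)[OF G, of f z] by (auto simp: Out_def)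
  qed (use x in simp)
  have "subgraph (component_of ?D x) H"
    unfolding subgraph_def
  proof (intro conjI)
    show "verts (component_of ?D x) \<subseteq> verts H" using stay by (auto simp: component_of_simps H_def)
    have "f \<in> Out" if f: "f \<in> edges (component_of ?D x)" for f
    proof -
      obtain w where "f \<in> edges G - F" "w \<in># ends G f" "reachable ?D x w"
        using f by (auto simp: component_of_simps)
      then show ?thesis using stay[of w] sides[of f] by (auto simp: I_def)
    qed
    then show "edges (component_of ?D x) \<subseteq> edges H"
      "\<forall>f\<in>edges (component_of ?D x). ends (component_of ?D x) f = ends H f"
      by (auto simp: component_of_simps(3) H_def)
  qed
  moreover have "component_of ?D x \<in> components ?D" using x(1) by (auto simp: components_def)
  moreover have "card (verts H) < card (verts G)"
    using uv(1) cubic_graphD(1)[OF G] by (auto simp: H_def S_def intro!: psubset_card_mono)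
  moreover have "F \<subseteq> edges G" by (auto simp: F_def)
  ultimately show False
    using irr H cardF x(2) unfolding irreducible_graph_def four_le_chromatic_index_iff by blast
qed

section \<open>From criticality to 6-irreducibility\<close>

lemma cubic_graph_even_order:
  assumes G: "cubic_graph G" shows "even (card (verts G))"
proof -
  have "fin_graph G" using G by (simp add: cubic_graph_def)
  from handshake[OF this order_refl] have "(\<Sum>v\<in>verts G. degree G v) = 2 * card (edges G)"
    by (simp add: degree_def)
  moreover have "(\<Sum>v\<in>verts G. degree G v) = 3 * card (verts G)"
    using cubic_graphD(5)[OF G] by simp
  ultimately show ?thesis by presburger
qed

text \<open>The loop \<open>l\<close> survives the removal of any adjacent pair avoiding
  \<open>x\<close> and blocks its colouring. Hence every non-loop edge reached from \<open>x\<close>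
  is incident with \<open>x\<close>, and walks lead no further than its neighbours.\<close>

lemma critical_loop_adjacent:
  assumes G: "cubic_graph G" and crit: "critical G" and l: "l \<in> edges G" "ends G l = {#x, x#}"
    and "reachable G x y"
  shows "y = x \<or> adjacent G x y"
  using assms(5) unfolding reachable_def
proof (induction rule: rtranclp_induct)
  case (step b z)
  show ?case
  proof (cases "b = x \<or> z = x")
    case True
    then show ?thesis using step.hyps by auto
  next
    case False
    have "b \<in> verts G" "z \<in> verts G"
      using step.hyps(2) cubic_graphD(4)[OF G] unfolding adjacent_def by force+
    then have "edge_colourable (remove_verts G {b, z}) 3"
      using crit step.hyps(2) by (auto simp: critical_def)
    moreover have "is_loop (remove_verts G {b, z}) l"
      using False l(2) by (auto simp: is_loop_def remove_verts_def)
    ultimately show ?thesis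
      using l(1) by (auto simp: edge_colourable_def proper_edge_colouring_def)
  qed
qed simp

lemma critical_imp_irreducible:
  assumes G: "cubic_graph G" and conn: "connected_graph G" and crit: "critical G"
  shows "irreducible_graph 6 G"
  unfolding irreducible_graph_def four_le_chromatic_index_iff
proof
  assume "\<exists>F C H. F \<subseteq> edges G \<and> card F < 6 \<and> C \<in> components (delete_edges G F) \<and>
    \<not> edge_colourable C 3 \<and> cubic_graph H \<and> subgraph C H \<and> card (verts H) < card (verts G)"
  then obtain F C H where F: "F \<subseteq> edges G" "card F < 6" and C: "C \<in> components (delete_edges G F)"
    "\<not> edge_colourable C 3" and H: "cubic_graph H" "subgraph C H" "card (verts H) < card (verts G)"
    by blast
  let ?D = "delete_edges G F"
  obtain x where x: "x \<in> verts G" "C = component_of ?D x" using C(1) by (auto simp: components_def)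
  define W where "W = {w \<in> verts G. reachable ?D x w}"
  have vC: "verts C = W" by (simp add: x(2) component_of_simps W_def)
  have eC: "edges C = {e \<in> edges G - F. set_mset (ends G e) \<inter> W \<noteq> {}}"
    by (simp add: x(2) component_of_simps W_def)
  have enC: "ends C = ends G" by (simp add: x(2) component_of_simps)
  have finV: "finite (verts G)" and finE: "finite (edges G)" using cubic_graphD(1,2)[OF G] by auto
  \<comment> \<open>An uncut edge leaving \<open>W\<close> would extend the set of reachable
    vertices.\<close>
  have boundary: "f \<in> F" if f: "f \<in> edges G" "a \<in># ends G f" "a \<in> W" "b \<in># ends G f" "b \<notin> W" for f a b
  proof (rule ccontr)
    assume "f \<notin> F"
    obtain y where y: "ends G f = {#a, y#}" using size_two_multiset cubic_graphD(3)[OF G f(1)] f(2) by metis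
    have "a \<noteq> b" using f by auto
    then have "y = b" using f(4) y by auto
    then have "adjacent ?D a b" using y f(1) \<open>f \<notin> F\<close> \<open>a \<noteq> b\<close> by (auto simp: adjacent_def)
    then have "reachable ?D x b" using f(3) unfolding W_def reachable_def by auto
    then show False using f(5) cubic_graphD(4)[OF G f(1) f(4)] by (simp add: W_def)
  qed
  \<comment> \<open>By \<open>boundary\<close>, edges of \<open>C\<close> have all ends in
    \<open>W\<close> and are unaffected by removing \<open>a\<close> and \<open>b\<close>; a
    colouring of the remaining graph would restrict to \<open>C\<close>.\<close>
  have indep: "\<not> adjacent G a b" if ab: "a \<in> verts G - W" "b \<in> verts G - W" for a b
  proof
    assume "adjacent G a b"
    then obtain c where c: "proper_edge_colouring (remove_verts G {a, b}) 3 c"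
      using crit ab by (auto simp: critical_def edge_colourable_def)
    have same: "ends (remove_verts G {a, b}) f = ends G f" if f: "f \<in> edges C" for f
    proof -
      have "w \<in> W" if "w \<in># ends G f" for w
        using boundary[of f _ w] f that by (auto simp: eC)
      then show ?thesis using ab by (auto simp: remove_verts_def filter_mset_eq_conv)
    qed
    have "edges C \<subseteq> edges G" by (auto simp: eC)
    then have "proper_edge_colouring C 3 c"
      using c same unfolding proper_edge_colouring_def is_loop_def enC edges_remove_verts
      by (metis subsetD)
    then show False using C(2) by (auto simp: edge_colourable_def)
  qed
  have "W \<subseteq> verts H" "finite (verts H)"
    using H vC cubic_graphD(1)[OF H(1)] by (auto simp: subgraph_def)
  then have "card W \<le> card (verts H)" by (intro card_mono)
  \<comment> \<open>Cubic graphs have even order, so a strict inequality of orders is a gap of at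
    least two.\<close>
  moreover have "card (verts H) + 2 \<le> card (verts G)"
    using H(3) cubic_graph_even_order[OF G] cubic_graph_even_order[OF H(1)] by presburger
  moreover have "W \<subseteq> verts G" "finite W" using finV by (auto simp: W_def)
  ultimately have "2 \<le> card (verts G - W)" by (simp add: card_Diff_subset)
  then obtain T where "T \<subseteq> verts G - W" "card T = 2" by (meson obtain_subset_with_card_n)
  then obtain a b where ab: "a \<in> verts G - W" "b \<in> verts G - W" "a \<noteq> b"
    by (auto simp: card_2_iff)
  \<comment> \<open>Connectedness leads from \<open>y\<close> to the other of the two vertices, so a
    loop at \<open>y\<close> would make them adjacent, against \<open>indep\<close>.\<close>
  have no_loop: "ends G l \<noteq> {#y, y#}" if lE: "l \<in> edges G" and y: "y \<in> {a, b}" for l y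
  proof
    assume l: "ends G l = {#y, y#}"
    obtain z where z: "z \<in> {a, b}" "z \<noteq> y" using ab(3) y by auto
    have "reachable G y z" using conn ab y z by (auto simp: connected_graph_def)
    then have "adjacent G y z" using critical_loop_adjacent[OF G crit lE l] z(2) by blast
    then show False using indep[of y z] ab y z by auto
  qed
  define N where "N y = {f \<in> edges G. y \<in># ends G f}" for y
  \<comment> \<open>All edges at \<open>y\<close> lead into \<open>W\<close>, since the outside is
    independent and \<open>y\<close> has no loop. They therefore lie in \<open>F\<close>, and the
    degree counts three distinct edges, possibly parallel.\<close>
  have NF: "N y \<subseteq> F" and cN: "card (N y) = 3" if y: "y \<in> {a, b}" for y
  proof -
    have yV: "y \<in> verts G - W" using y ab by auto
    have ne: "\<exists>z. ends G f = {#y, z#} \<and> z \<noteq> y \<and> z \<in> verts G" if f: "f \<in> N y" for f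
    proof -
      have fE: "f \<in> edges G" "y \<in># ends G f" using f by (auto simp: N_def)
      obtain z where "ends G f = {#y, z#}" using size_two_multiset cubic_graphD(3)[OF G fE(1)] fE(2) by metis
      then show ?thesis using no_loop[OF fE(1) y] cubic_graphD(4)[OF G fE(1), of z] by auto
    qed
    show "N y \<subseteq> F"
    proof
      fix f assume f: "f \<in> N y"
      then have fE: "f \<in> edges G" by (simp add: N_def)
      obtain z where z: "ends G f = {#y, z#}" "z \<noteq> y" "z \<in> verts G" using ne[OF f] by blast
      then have "adjacent G y z" using fE by (auto simp: adjacent_def)
      then have "z \<in> W" using indep[OF yV, of z] z(3) by auto
      then show "f \<in> F" using boundary[OF fE, of z y] z yV by auto
    qed
    have "3 = degree G y" using cubic_graphD(5)[OF G, of y] yV by simp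
    also have "\<dots> = (\<Sum>f\<in>N y. count (ends G f) y)"
      unfolding degree_def using finE by (intro sum.mono_neutral_right) (auto simp: N_def count_eq_zero_iff)
    also have "\<dots> = (\<Sum>f\<in>N y. 1)"
    proof (rule sum.cong)
      fix f assume "f \<in> N y"
      then show "count (ends G f) y = 1" using ne[of f] by auto
    qed simp
    finally show "card (N y) = 3" by simp
  qed
  \<comment> \<open>A common edge would join \<open>a\<close> and \<open>b\<close>. The two triples
    are thus disjoint and force six edges in \<open>F\<close>.\<close>
  have "N a \<inter> N b = {}"
  proof (rule ccontr)
    assume "\<not> ?thesis"
    then obtain f where f: "f \<in> edges G" "a \<in># ends G f" "b \<in># ends G f" by (auto simp: N_def)
    obtain z where z: "ends G f = {#a, z#}" using size_two_multiset cubic_graphD(3)[OF G f(1)] f(2) by metis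
    then have "z = b" using f(3) ab(3) by auto
    then show False using indep[OF ab(1,2)] z f(1) ab(3) by (auto simp: adjacent_def)
  qed
  moreover have finF: "finite F" using F(1) finE finite_subset by blast
  ultimately have "card (N a \<union> N b) = 6"
    using cN[of a] cN[of b] by (subst card_Un_disjoint) (auto simp: N_def finE)
  moreover have "card (N a \<union> N b) \<le> card F" using NF[of a] NF[of b] finF by (intro card_mono) auto
  ultimately show False using F(2) by simp
qed

lemma irreducible_graph_mono:
  assumes "irreducible_graph l G" "k \<le> l" shows "irreducible_graph k G"
  using assms unfolding irreducible_graph_def by (meson less_le_trans)

theorem theorem4:
  fixes G :: "('v, 'e) multigraph"
  assumes "snark G"
  shows "(critical G \<longleftrightarrow> four_edge_critical G) \<and>
         (critical G \<longleftrightarrow> irreducible_graph 5 G) \<and>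
         (critical G \<longleftrightarrow> irreducible_graph 6 G) \<and>
         (critical G \<longleftrightarrow> (\<forall>e\<in>edges G. \<not> is_loop G e \<longrightarrow> edge_colourable (delete_suppress G e) 3))"
proof -
  have G: "cubic_graph G" "connected_graph G" "\<not> edge_colourable G 3"
    using assms by (auto simp: snark_def)
  \<comment> \<open>This link closes the cycle from criticality to 6-irreducibility, to
    5-irreducibility and back.\<close>
  have "irreducible_graph 6 G \<Longrightarrow> irreducible_graph 5 G"
    by (rule irreducible_graph_mono) auto
  then show ?thesis
    using critical_iff_four_edge_critical[OF G(1)] critical_iff_delete_suppress[OF G(1,3)]
      critical_imp_irreducible[OF G(1,2)] irreducible_imp_critical[OF G(1)] by blast
qed

end
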